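(* Let $\Gamma$ be any planar 4-ary construction in which every vertex is assigned an eight-vertex constraint function whose parameter tuple $(a,b,c,d)$ satisfies $a+d\le b+c$, $b+d\le a+c$, $c+d\ge a+b$, and $a\le b+c+d$, $b\le a+c+d$, $c\le a+b+d$, $d\le a+b+c$. Then the constraint function defined by $\Gamma$ is an eight-vertex constraint function whose parameters $(a',b',c',d')$ satisfy the same seven inequalities. That is, the set of eight-vertex constraint functions with parameters in $\mathcal{A}_\le\cap\mathcal{B}_\le\cap\mathcal{C}_\ge\cap\overline{\mathcal{F}_>}$ is closed under planar 4-ary constructions.
   Context: An eight-vertex constraint function with parameters $(a,b,c,d)\in\mathbb{R}_{\ge 0}^4$ is the function $f:\{0,1\}^4\to\mathbb{R}_{\ge0}$ given by $f(0011)=f(1100)=a$, $f(0110)=f(1001)=b$, $f(0101)=f(1010)=c$, $f(0000)=f(1111)=d$, and $f(x)=0$ whenever $x$ has an odd number of ones. It is placed at a vertex whose four incident edge-ends are labeled $e_1,e_2,e_3,e_4$; given an orientation of the edges, the $i$-th input bit is $0$ if $e_i$ points into the vertex and $1$ if it points out. Regions (subsets of $\mathbb{R}_{\ge0}^4$): $\mathcal{A}_\le=\{a+d\le b+c\}$, $\mathcal{B}_\le=\{b+d\le a+c\}$, $\mathcal{C}_\ge=\{c+d\ge a+b\}$, and $\overline{\mathcal{F}_>}=\{a\le b+c+d,\ b\le a+c+d,\ c\le a+b+d,\ d\le a+b+c\}$. A 4-ary construction is a finite graph $\Gamma$ (multiple edges and loops allowed) together with four dangling edges $e_1,\dots,e_4$,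 each attached at one end to a vertex of $\Gamma$, such that every vertex has degree exactly $4$ (counting dangling edges, loops twice); at each vertex the four incident edge-ends are labeled $1,2,3,4$ and a constraint function is assigned. Its constraint function is $f(b_1b_2b_3b_4)=\sum_\sigma\prod_v f_v(\sigma|_v)$, summed over all orientations $\sigma$ of the internal edges, with dangling edge $e_i$ oriented into $\Gamma$ if $b_i=0$ and out of $\Gamma$ if $b_i=1$. A planar 4-ary construction is one where $\Gamma$ is embedded in the plane, the four dangling edges lie on the outer face in counterclockwise order $e_1,e_2,e_3,e_4$, and (as in the planar eight-vertex model) at every vertex the labels $1,2,3,4$ of the incident edge-ends follow the counterclockwise cyclic order of the embedding. *)

theory Defs
  imports "HOL-Analysis.Analysis" "HOL-Library.FuncSet"
begin

type_synonym constraint = "bool \<Rightarrow> bool \<Rightarrow> bool \<Rightarrow> bool \<Rightarrow> real"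

definition nonneg_params :: "(real \<times> real \<times> real \<times> real) set" where
  "nonneg_params = {(a, b, c, d). 0 \<le> a \<and> 0 \<le> b \<and> 0 \<le> c \<and> 0 \<le> d}"

text \<open>The bits 0 and 1 are \<open>False\<close> and \<open>True\<close>.\<close>

definition eight_vertex :: "real \<times> real \<times> real \<times> real \<Rightarrow> constraint" where
  "eight_vertex = (\<lambda>(a, b, c, d) x1 x2 x3 x4.
     if (x1, x2, x3, x4) \<in> {(False, False, True, True), (True, True, False, False)} then a
     else if (x1, x2, x3, x4) \<in> {(False, True, True, False), (True, False, False, True)} then b
     else if (x1, x2, x3, x4) \<in> {(False, True, False, True), (True, False, True, False)} then c
     else if (x1, x2, x3, x4) \<in> {(False, False, False, False), (True, True, True, True)} then d
     else 0)"

definition A_le :: "(real \<times> real \<times> real \<times> real) set" where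
  "A_le = {(a, b, c, d) \<in> nonneg_params. a + d \<le> b + c}"

definition B_le :: "(real \<times> real \<times> real \<times> real) set" where
  "B_le = {(a, b, c, d) \<in> nonneg_params. b + d \<le> a + c}"

definition C_ge :: "(real \<times> real \<times> real \<times> real) set" where
  "C_ge = {(a, b, c, d) \<in> nonneg_params. c + d \<ge> a + b}"

definition F_bar :: "(real \<times> real \<times> real \<times> real) set" where
  "F_bar = {(a, b, c, d) \<in> nonneg_params.
     a \<le> b + c + d \<and> b \<le> a + c + d \<and> c \<le> a + b + d \<and> d \<le> a + b + c}"

datatype 'e edge = Internal 'e | Dangling nat

text \<open>
  An edge-end is a pair \<open>(x, s)\<close>: \<open>(x, False)\<close> is the start of the edge \<open>x\<close> and
  \<open>(x, True)\<close> its finish. The choice of start and finish of an internal edge is an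
  arbitrary reference direction; a dangling edge is attached to a vertex at its start
  only. \<open>end_at G v i\<close> is the edge-end labelled \<open>i\<close> at the vertex \<open>v\<close>.
\<close>

record ('v, 'e) construction =
  verts :: "'v set"
  edges :: "'e set"
  end_at :: "'v \<Rightarrow> nat \<Rightarrow> 'e edge \<times> bool"
  weight :: "'v \<Rightarrow> constraint"

definition all_edges :: "('v, 'e) construction \<Rightarrow> 'e edge set" where
  "all_edges G = Internal ` edges G \<union> Dangling ` {1..4}"

definition edge_ends :: "('v, 'e) construction \<Rightarrow> ('e edge \<times> bool) set" where
  "edge_ends G = (Internal ` edges G) \<times> UNIV \<union> (Dangling ` {1..4}) \<times> {False}"

text \<open>
  The bijection says that every edge-end is attached to exactly one vertex, and that each
  vertex has exactly four edge-ends (a loop contributing two), labelled 1, 2, 3, 4.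
\<close>

definition four_ary_construction :: "('v, 'e) construction \<Rightarrow> bool" where
  "four_ary_construction G \<longleftrightarrow>
     finite (verts G) \<and> finite (edges G) \<and>
     bij_betw (\<lambda>(v, i). end_at G v i) (verts G \<times> {1..4}) (edge_ends G)"

text \<open>
  \<open>\<sigma> e\<close> means that the internal edge \<open>e\<close> is oriented from its start to its finish, and
  \<open>b i\<close> is the bit of the \<open>i\<close>-th dangling edge. The result is the bit seen by the vertex
  at that edge-end: \<open>True\<close> iff the edge points out of the vertex.
\<close>

fun end_bit :: "('e \<Rightarrow> bool) \<Rightarrow> (nat \<Rightarrow> bool) \<Rightarrow> 'e edge \<times> bool \<Rightarrow> bool" where
  "end_bit \<sigma> b (Internal e, s) = (if s then \<not> \<sigma> e else \<sigma> e)"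
| "end_bit \<sigma> b (Dangling i, s) = b i"

definition constraint_function :: "('v, 'e) construction \<Rightarrow> constraint" where
  "constraint_function G b1 b2 b3 b4 =
     (let b = (\<lambda>i. [b1, b2, b3, b4] ! (i - 1)) in
      \<Sum>\<sigma>\<in>edges G \<rightarrow>\<^sub>E (UNIV :: bool set). \<Prod>v\<in>verts G.
        weight G v (end_bit \<sigma> b (end_at G v 1)) (end_bit \<sigma> b (end_at G v 2))
                   (end_bit \<sigma> b (end_at G v 3)) (end_bit \<sigma> b (end_at G v 4)))"

text \<open>
  The points \<open>p 1, p 2, p 3, p 4\<close> are distinct and occur in this counterclockwise cyclic
  order on the circle with centre \<open>z\<close> and radius \<open>r\<close>.
\<close>

definition ccw_on_circle :: "complex \<Rightarrow> real \<Rightarrow> (nat \<Rightarrow> complex) \<Rightarrow> bool" where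
  "ccw_on_circle z r p \<longleftrightarrow> (\<exists>\<theta> :: nat \<Rightarrow> real.
     (\<forall>i\<in>{1..4}. p i = z + of_real r * cis (\<theta> i)) \<and>
     \<theta> 1 < \<theta> 2 \<and> \<theta> 2 < \<theta> 3 \<and> \<theta> 3 < \<theta> 4 \<and> \<theta> 4 < \<theta> 1 + 2 * pi)"

definition first_hit :: "(real \<Rightarrow> complex) \<Rightarrow> complex \<Rightarrow> real \<Rightarrow> complex \<Rightarrow> bool" where
  "first_hit g z r p \<longleftrightarrow>
     (\<exists>t\<in>{0..1}. g t = p \<and> dist z p = r \<and> (\<forall>s\<in>{0..<t}. dist z (g s) < r))"

text \<open>The curve of an edge, traversed away from the given edge-end.\<close>

fun end_curve :: "('e edge \<Rightarrow> real \<Rightarrow> complex) \<Rightarrow> 'e edge \<times> bool \<Rightarrow> real \<Rightarrow> complex" where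
  "end_curve \<gamma> (x, s) = (if s then reversepath (\<gamma> x) else \<gamma> x)"

text \<open>
  A drawing in the plane, with vertices at the points \<open>pos v\<close> and edges along the curves
  \<open>\<gamma> x\<close>. That the dangling edges lie on the outer face in counterclockwise order is
  expressed by drawing everything inside a large disc, the free ends of the dangling edges
  being on its boundary circle in that order. Since edges are merely continuous and need not
  have tangents at a vertex, the cyclic order of the edge-ends at \<open>v\<close> is read off from
  the points in which they first leave a sufficiently small disc around \<open>pos v\<close>.
\<close>

definition plane_drawing ::
    "('v, 'e) construction \<Rightarrow> ('v \<Rightarrow> complex) \<Rightarrow> ('e edge \<Rightarrow> real \<Rightarrow> complex) \<Rightarrow> bool" where
  "plane_drawing G pos \<gamma> \<longleftrightarrow>
     inj_on pos (verts G) \<and>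
     (\<forall>x\<in>all_edges G. simple_path (\<gamma> x)) \<and>
     (\<forall>v\<in>verts G. \<forall>i\<in>{1..4}. pathstart (end_curve \<gamma> (end_at G v i)) = pos v) \<and>
     (\<forall>x\<in>all_edges G. \<gamma> x ` {0<..<1} \<inter> pos ` verts G = {}) \<and>
     (\<forall>x\<in>all_edges G. \<forall>y\<in>all_edges G. x \<noteq> y \<longrightarrow> \<gamma> x ` {0<..<1} \<inter> \<gamma> y ` {0<..<1} = {}) \<and>
     (\<exists>R>0.
        (\<forall>e\<in>edges G. path_image (\<gamma> (Internal e)) \<subseteq> ball 0 R) \<and>
        (\<forall>i\<in>{1..4}. \<gamma> (Dangling i) ` {0..<1} \<subseteq> ball 0 R) \<and>
        ccw_on_circle 0 R (\<lambda>i. pathfinish (\<gamma> (Dangling i)))) \<and>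
     (\<forall>v\<in>verts G. eventually (\<lambda>r. \<exists>p. ccw_on_circle (pos v) r p \<and>
        (\<forall>i\<in>{1..4}. first_hit (end_curve \<gamma> (end_at G v i)) (pos v) r (p i))) (at_right 0))"

definition planar_four_ary_construction :: "('v, 'e) construction \<Rightarrow> bool" where
  "planar_four_ary_construction G \<longleftrightarrow>
     four_ary_construction G \<and> (\<exists>pos \<gamma>. plane_drawing G pos \<gamma>)"

end

theory Submission
  imports Defs "HOL-Complex_Analysis.Winding_Numbers"
begin

text \<open>
  Fourier transformation over \<open>{0, 1}\<close> turns \<open>(a, b, c, d)\<close> into
  \<open>(a + d - b - c, b + d - a - c, c + d - a - b, a + b + c + d)\<close>; the seven inequalities, together with
  nonnegativity, say that this has the form \<open>(- A, - B, C, D)\<close> with \<open>A, B, C \<ge> 0\<close> and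
  \<open>A + B + C \<le> D\<close>. The transformed constraint function of the construction is a sum over
  red/green colourings of the edges, with a factor \<open>-1\<close> for every red internal edge, which can be
  nonzero only if every vertex has an even number of red ends.

  Signs: after regrouping, a colouring contributes \<open>-1\<close> for each vertex at which red crosses green,
  and in the plane the parity of the number of such vertices depends only on the
  colours of the dangling edges. Indeed, let every red arc from \<open>u\<close> to
  \<open>w\<close> contribute a square root of \<open>(u - z) * (w - z)\<close> branched along the arc. Suitably normalised,
  the product of these is a continuous function with values \<open>1\<close> and \<open>-1\<close> off the red edges. It is constant on each green edge, and takes different values on two
  green ends at a vertex exactly if the red ends separate them.

  Size: with the signs removed, the vertex weights are nonnegative combinations of
  systems of equalities between the colours of the ends, and for each choice of such systems
  at all vertices the inequality \<open>A + B + C \<le> D\<close> compares numbers of solutions.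
\<close>

section \<open>Sums over colourings\<close>

text \<open>The character \<open>(-1)^(x*y)\<close> of the two-element group; products of four of
  these are the characters of \<open>{0, 1}^4\<close>.\<close>

definition chi :: "bool \<Rightarrow> bool \<Rightarrow> real" where
  "chi x y = (if x \<and> y then -1 else 1)"

text \<open>Fourier inversion on \<open>{0, 1}^4\<close>. Evenness and invariance under flipping all
  four bits are dual to each other, so the transform is again of eight-vertex form. Each parameter
  occurs at two complementary words, which leaves \<open>16 / 2 = 8\<close> as the normalising
  factor.\<close>

lemma eight_vertex_fourier:
  "8 * eight_vertex (a, b, c, d) x1 x2 x3 x4 =
     (\<Sum>y1\<in>UNIV. \<Sum>y2\<in>UNIV. \<Sum>y3\<in>UNIV. \<Sum>y4\<in>UNIV.
        eight_vertex (a + d - b - c, b + d - a - c, c + d - a - b, a + b + c + d) y1 y2 y3 y4 *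
        (chi y1 x1 * chi y2 x2 * chi y3 x3 * chi y4 x4))"
  by (cases x1; cases x2; cases x3; cases x4) (simp_all add: UNIV_bool eight_vertex_def chi_def)

lemma atLeastAtMost_1_4: "{1..4::nat} = {1, 2, 3, 4}"
  by auto

lemma prod_1_4: "(\<Prod>i\<in>{1..4::nat}. f i) = f 1 * f 2 * f 3 * (f 4 :: 'a :: comm_monoid_mult)"
  by (simp add: atLeastAtMost_1_4 mult.assoc del: One_nat_def)

lemma sum_1_4: "(\<Sum>i\<in>{1..4::nat}. f i) = f 1 + f 2 + f 3 + (f 4 :: 'a :: comm_monoid_add)"
  by (simp add: atLeastAtMost_1_4 add.assoc del: One_nat_def)

section \<open>Double counting of edge-ends\<close>

lemma finite_edge_ends: "four_ary_construction G \<Longrightarrow> finite (edge_ends G)"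
  by (simp add: four_ary_construction_def edge_ends_def)

lemma finite_all_edges: "four_ary_construction G \<Longrightarrow> finite (all_edges G)"
  by (simp add: four_ary_construction_def all_edges_def)

lemma end_at_in_edge_ends:
  "\<lbrakk>four_ary_construction G; v \<in> verts G; i \<in> {1..4}\<rbrakk> \<Longrightarrow> end_at G v i \<in> edge_ends G"
  unfolding four_ary_construction_def by (auto dest!: bij_betw_apply[of _ _ _ "(v, i)"])

lemma fst_edge_ends: "x \<in> edge_ends G \<Longrightarrow> fst x \<in> all_edges G"
  by (auto simp: edge_ends_def all_edges_def)

text \<open>Together with \<open>prod_edge_ends\<close> this counts the edge-ends in two ways, by
  vertices and by edges: an internal edge fills two labelled slots, a dangling edge one.\<close>

lemma prod_over_vertices:
  fixes q :: "'e edge \<times> bool \<Rightarrow> 'a :: comm_monoid_mult"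
  assumes G: "four_ary_construction G"
  shows "(\<Prod>v\<in>verts G. \<Prod>i\<in>{1..4}. q (end_at G v i)) = prod q (edge_ends G)"
proof -
  have "(\<Prod>v\<in>verts G. \<Prod>i\<in>{1..4}. q (end_at G v i)) =
        (\<Prod>(v, i)\<in>verts G \<times> {1..4}. q (end_at G v i))"
    using G by (subst prod.cartesian_product) (auto simp: four_ary_construction_def)
  also have "\<dots> = (\<Prod>w\<in>verts G \<times> {1..4}. q ((\<lambda>(v, i). end_at G v i) w))"
    by (simp add: case_prod_beta)
  also have "\<dots> = prod q (edge_ends G)"
    using G unfolding four_ary_construction_def by (intro prod.reindex_bij_betw) auto
  finally show ?thesis .
qed

lemma prod_edge_ends:
  fixes q :: "'e edge \<times> bool \<Rightarrow> 'a :: comm_monoid_mult"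
  assumes G: "four_ary_construction G"
  shows "prod q (edge_ends G) =
    (\<Prod>e\<in>edges G. q (Internal e, False) * q (Internal e, True)) *
    (\<Prod>i\<in>{1..4}. q (Dangling i, False))"
proof -
  have fin: "finite (edges G)" using G by (simp add: four_ary_construction_def)
  have "prod q (edge_ends G) = prod q ((Internal ` edges G) \<times> UNIV) *
      prod q ((Dangling ` {1..4}) \<times> {False})"
    unfolding edge_ends_def using fin by (intro prod.union_disjoint) auto
  also have "prod q ((Internal ` edges G) \<times> UNIV) =
      (\<Prod>x\<in>Internal ` edges G. \<Prod>s\<in>UNIV. q (x, s))"
    using fin by (simp add: prod.cartesian_product)
  also have "\<dots> = (\<Prod>e\<in>edges G. q (Internal e, False) * q (Internal e, True))"
    by (subst prod.reindex) (auto simp: inj_on_def UNIV_bool intro!: prod.cong)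
  also have "prod q ((Dangling ` {1..4}) \<times> {False}) = (\<Prod>x\<in>Dangling ` {1..4}. \<Prod>s\<in>{False}. q (x, s))"
    by (subst prod.cartesian_product) (auto intro!: prod.cong)
  also have "\<dots> = (\<Prod>i\<in>{1..4}. q (Dangling i, False))"
    by (subst prod.reindex) (auto simp: inj_on_def)
  finally show ?thesis .
qed

text \<open>The two ways of multiplying over edge-ends, applied to powers of 2, give equal powers;
  comparing exponents turns products into sums.\<close>

lemma handshake:
  fixes q :: "'e edge \<Rightarrow> nat"
  assumes G: "four_ary_construction G"
  shows "(\<Sum>v\<in>verts G. \<Sum>i\<in>{1..4}. q (fst (end_at G v i))) =
    2 * (\<Sum>e\<in>edges G. q (Internal e)) + (\<Sum>i\<in>{1..4}. q (Dangling i))"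
proof -
  have fin: "finite (edges G)" "finite (verts G)"
    using G by (simp_all add: four_ary_construction_def)
  have "(2::nat) ^ (\<Sum>v\<in>verts G. \<Sum>i\<in>{1..4}. q (fst (end_at G v i))) =
      2 ^ (2 * (\<Sum>e\<in>edges G. q (Internal e)) + (\<Sum>i\<in>{1..4}. q (Dangling i)))"
    using prod_over_vertices[OF G, of "\<lambda>x. 2 ^ q (fst x) :: nat"]
      prod_edge_ends[OF G, of "\<lambda>x. 2 ^ q (fst x) :: nat"] fin
    by (simp add: power_sum power_add sum_distrib_left mult_2)
  then show ?thesis by (simp only: power_inject_exp)
qed

text \<open>Distributivity: choosing four bits independently at every vertex amounts to choosing one
  bit for every edge-end, because each edge-end occupies exactly one labelled slot. The two ends of
  an internal edge may still carry different bits.\<close>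

lemma prod_sum_vertices:
  fixes F :: "'v \<Rightarrow> bool \<Rightarrow> bool \<Rightarrow> bool \<Rightarrow> bool \<Rightarrow> real"
  assumes G: "four_ary_construction (G :: ('v, 'e) construction)"
  shows "(\<Prod>v\<in>verts G. \<Sum>y1\<in>UNIV. \<Sum>y2\<in>UNIV. \<Sum>y3\<in>UNIV. \<Sum>y4\<in>UNIV. F v y1 y2 y3 y4) =
    (\<Sum>Y\<in>edge_ends G \<rightarrow>\<^sub>E UNIV. \<Prod>v\<in>verts G.
       F v (Y (end_at G v 1)) (Y (end_at G v 2)) (Y (end_at G v 3)) (Y (end_at G v 4)))"
proof -
  let ?Q = "{1..4::nat} \<rightarrow>\<^sub>E (UNIV :: bool set)"
  let ?V = "verts G"
  have fin: "finite ?V" using G by (simp add: four_ary_construction_def)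
  have bij: "bij_betw (\<lambda>(v, i). end_at G v i) (?V \<times> {1..4}) (edge_ends G)"
    using G by (simp add: four_ary_construction_def)
  define loc where "loc = the_inv_into (?V \<times> {1..4}) (\<lambda>(v, i). end_at G v i)"
  have loc: "loc (end_at G v i) = (v, i)" if "v \<in> ?V" "i \<in> {1..4}" for v i
    using bij that the_inv_into_f_f[of "\<lambda>(v, i). end_at G v i" "?V \<times> {1..4}" "(v, i)"]
    by (simp add: loc_def bij_betw_def)
  have surj: "\<exists>v i. v \<in> ?V \<and> i \<in> {1..4} \<and> x = end_at G v i" if "x \<in> edge_ends G" for x
  proof -
    have "x \<in> (\<lambda>(v, i). end_at G v i) ` (?V \<times> {1..4})"
      using that by (simp only: bij_betw_imp_surj_on[OF bij])
    then show ?thesis by force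
  qed
  have list: "restrict (\<lambda>i. [y 1, y 2, y 3, y 4] ! (i - 1)) {1..4} = y" if "y \<in> ?Q" for y
  proof (rule ext)
    fix i
    show "restrict (\<lambda>i. [y 1, y 2, y 3, y 4] ! (i - 1)) {1..4} i = y i"
    proof (cases "i \<in> {1..4}")
      case True
      then have "i = 1 \<or> i = 2 \<or> i = 3 \<or> i = 4" by auto
      then show ?thesis by (elim disjE) simp_all
    qed (use that in \<open>auto simp: PiE_def extensional_def\<close>)
  qed
  have bits: "(\<Sum>y1\<in>UNIV. \<Sum>y2\<in>UNIV. \<Sum>y3\<in>UNIV. \<Sum>y4\<in>UNIV. h y1 y2 y3 y4) =
      (\<Sum>y\<in>?Q. h (y 1) (y 2) (y 3) (y 4))" for h :: "bool \<Rightarrow> bool \<Rightarrow> bool \<Rightarrow> bool \<Rightarrow> real"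
  proof -
    have "(\<Sum>y\<in>?Q. h (y 1) (y 2) (y 3) (y 4)) =
        (\<Sum>(y1, y2, y3, y4)\<in>UNIV. h y1 y2 y3 y4)"
    proof (rule sum.reindex_bij_witness[where
          j = "\<lambda>y. (y 1, y 2, y 3, y 4)" and
          i = "\<lambda>(y1, y2, y3, y4). restrict (\<lambda>i. [y1, y2, y3, y4] ! (i - 1)) {1..4}"])
      fix y assume "y \<in> ?Q"
      then show "(case (y 1, y 2, y 3, y 4) of (y1, y2, y3, y4) \<Rightarrow>
          restrict (\<lambda>i. [y1, y2, y3, y4] ! (i - 1)) {1..4}) = y"
        by (simp only: list prod.case)
    next
      fix b :: "bool \<times> bool \<times> bool \<times> bool"
      obtain y1 y2 y3 y4 where "b = (y1, y2, y3, y4)" by (cases b) auto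
      then show "((case b of (y1, y2, y3, y4) \<Rightarrow> restrict (\<lambda>i. [y1, y2, y3, y4] ! (i - 1)) {1..4}) 1,
          (case b of (y1, y2, y3, y4) \<Rightarrow> restrict (\<lambda>i. [y1, y2, y3, y4] ! (i - 1)) {1..4}) 2,
          (case b of (y1, y2, y3, y4) \<Rightarrow> restrict (\<lambda>i. [y1, y2, y3, y4] ! (i - 1)) {1..4}) 3,
          (case b of (y1, y2, y3, y4) \<Rightarrow> restrict (\<lambda>i. [y1, y2, y3, y4] ! (i - 1)) {1..4}) 4) = b"
        by simp
    qed (auto split: prod.splits)
    then show ?thesis
      by (simp add: sum.cartesian_product case_prod_beta)
  qed
  have "(\<Prod>v\<in>?V. \<Sum>y1\<in>UNIV. \<Sum>y2\<in>UNIV. \<Sum>y3\<in>UNIV. \<Sum>y4\<in>UNIV. F v y1 y2 y3 y4) =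
      (\<Prod>v\<in>?V. \<Sum>y\<in>?Q. F v (y 1) (y 2) (y 3) (y 4))"
    by (simp only: bits)
  also have "\<dots> = (\<Sum>Z\<in>?V \<rightarrow>\<^sub>E ?Q. \<Prod>v\<in>?V. F v (Z v 1) (Z v 2) (Z v 3) (Z v 4))"
    by (rule prod_sum_PiE) (use fin in \<open>auto intro: finite_PiE\<close>)
  also have "\<dots> = (\<Sum>Y\<in>edge_ends G \<rightarrow>\<^sub>E UNIV. \<Prod>v\<in>?V.
       F v (Y (end_at G v 1)) (Y (end_at G v 2)) (Y (end_at G v 3)) (Y (end_at G v 4)))"
  proof (rule sum.reindex_bij_witness[where
        i = "\<lambda>Y. restrict (\<lambda>v. restrict (\<lambda>i. Y (end_at G v i)) {1..4}) ?V" and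
        j = "\<lambda>Z. restrict (\<lambda>x. Z (fst (loc x)) (snd (loc x))) (edge_ends G)"])
    fix Z assume Z: "Z \<in> ?V \<rightarrow>\<^sub>E ?Q"
    have eq: "restrict (\<lambda>x. Z (fst (loc x)) (snd (loc x))) (edge_ends G) (end_at G v i) = Z v i"
      if "v \<in> ?V" "i \<in> {1..4}" for v i
      using end_at_in_edge_ends[OF G that] loc[OF that] by simp
    show "restrict (\<lambda>v. restrict (\<lambda>i. restrict (\<lambda>x. Z (fst (loc x)) (snd (loc x))) (edge_ends G)
         (end_at G v i)) {1..4}) ?V = Z"
    proof (rule ext)
      fix v
      show "restrict (\<lambda>v. restrict (\<lambda>i. restrict (\<lambda>x. Z (fst (loc x)) (snd (loc x))) (edge_ends G)
         (end_at G v i)) {1..4}) ?V v = Z v"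
      proof (cases "v \<in> ?V")
        case True
        then have "Z v \<in> ?Q" using Z by auto
        then show ?thesis using True eq[OF True] by (auto simp: fun_eq_iff PiE_def extensional_def)
      qed (use Z in \<open>auto simp: PiE_def extensional_def\<close>)
    qed
    show "(\<Prod>v\<in>?V. F v
        (restrict (\<lambda>x. Z (fst (loc x)) (snd (loc x))) (edge_ends G) (end_at G v 1))
        (restrict (\<lambda>x. Z (fst (loc x)) (snd (loc x))) (edge_ends G) (end_at G v 2))
        (restrict (\<lambda>x. Z (fst (loc x)) (snd (loc x))) (edge_ends G) (end_at G v 3))
        (restrict (\<lambda>x. Z (fst (loc x)) (snd (loc x))) (edge_ends G) (end_at G v 4))) =
        (\<Prod>v\<in>?V. F v (Z v 1) (Z v 2) (Z v 3) (Z v 4))"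
      by (intro prod.cong refl) (simp add: eq del: One_nat_def restrict_apply)
  next
    fix Y assume Y: "Y \<in> edge_ends G \<rightarrow>\<^sub>E (UNIV :: bool set)"
    show "restrict (\<lambda>x. restrict (\<lambda>v. restrict (\<lambda>i. Y (end_at G v i)) {1..4}) ?V
        (fst (loc x)) (snd (loc x))) (edge_ends G) = Y"
    proof (rule ext)
      fix x
      show "restrict (\<lambda>x. restrict (\<lambda>v. restrict (\<lambda>i. Y (end_at G v i)) {1..4}) ?V
          (fst (loc x)) (snd (loc x))) (edge_ends G) x = Y x"
      proof (cases "x \<in> edge_ends G")
        case True
        then obtain v i where "v \<in> ?V" "i \<in> {1..4}" "x = end_at G v i" using surj by blast
        then show ?thesis using True loc[of v i] by simp
      qed (cases x, use Y in \<open>simp add: PiE_def extensional_def\<close>)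
    qed
  qed auto
  finally show ?thesis .
qed

section \<open>Fourier expansion of the constraint function over edge colourings\<close>

abbreviation at_vertex :: "('v, 'e) construction \<Rightarrow> (bool \<Rightarrow> bool \<Rightarrow> bool \<Rightarrow> bool \<Rightarrow> 'a) \<Rightarrow>
    ('e edge \<Rightarrow> bool) \<Rightarrow> 'v \<Rightarrow> 'a" where
  "at_vertex G h \<beta> v \<equiv> h (\<beta> (fst (end_at G v 1))) (\<beta> (fst (end_at G v 2)))
                           (\<beta> (fst (end_at G v 3))) (\<beta> (fst (end_at G v 4)))"

abbreviation at_boundary :: "(bool \<Rightarrow> bool \<Rightarrow> bool \<Rightarrow> bool \<Rightarrow> 'a) \<Rightarrow> ('e edge \<Rightarrow> bool) \<Rightarrow> 'a" where
  "at_boundary h \<beta> \<equiv> h (\<beta> (Dangling 1)) (\<beta> (Dangling 2)) (\<beta> (Dangling 3)) (\<beta> (Dangling 4))"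

definition spectrum :: "real \<times> real \<times> real \<times> real \<Rightarrow> real \<times> real \<times> real \<times> real" where
  "spectrum = (\<lambda>(a, b, c, d). (a + d - b - c, b + d - a - c, c + d - a - b, a + b + c + d))"

definition edge_sign :: "bool \<Rightarrow> real" where
  "edge_sign y = (if y then -1 else 1)"

text \<open>Expanding each vertex weight by \<open>eight_vertex_fourier\<close> puts a dual bit on
  every edge-end. Summing over the orientation of an internal edge then kills every term whose dual
  bits at its two ends differ; for equal bits \<open>y\<close> there remains
  \<open>2 * edge_sign y\<close>, since the two ends see opposite bits.\<close>

lemma constraint_function_fourier:
  assumes G: "four_ary_construction (G :: ('v, 'e) construction)"
    and w: "\<And>v. v \<in> verts G \<Longrightarrow> weight G v = eight_vertex (p v)"
  shows "8 ^ card (verts G) * constraint_function G b1 b2 b3 b4 =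
    2 ^ card (edges G) * (\<Sum>\<beta>\<in>all_edges G \<rightarrow>\<^sub>E UNIV.
      (\<Prod>v\<in>verts G. at_vertex G (eight_vertex (spectrum (p v))) \<beta> v) *
      (\<Prod>e\<in>edges G. edge_sign (\<beta> (Internal e))) *
      at_boundary (\<lambda>y1 y2 y3 y4. chi y1 b1 * chi y2 b2 * chi y3 b3 * chi y4 b4) \<beta>)"
proof -
  let ?V = "verts G" and ?E = "edges G" and ?X = "edge_ends G"
  let ?b = "\<lambda>i. [b1, b2, b3, b4] ! (i - 1)"
  let ?g = "\<lambda>v. eight_vertex (spectrum (p v))"
  have fin: "finite ?V" "finite ?E" using G by (simp_all add: four_ary_construction_def)
  define wt where "wt Y = (\<Prod>v\<in>?V. ?g v (Y (end_at G v 1)) (Y (end_at G v 2))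
      (Y (end_at G v 3)) (Y (end_at G v 4)))" for Y
  define bd where "bd Y = (\<Prod>i\<in>{1..4}. chi (Y (Dangling i, False)) (?b i))"
    for Y :: "'e edge \<times> bool \<Rightarrow> bool"
  define summand where "summand \<beta> = (\<Prod>v\<in>?V. at_vertex G (?g v) \<beta> v) *
      ((\<Prod>e\<in>?E. 2 * edge_sign (\<beta> (Internal e))) *
       at_boundary (\<lambda>y1 y2 y3 y4. chi y1 b1 * chi y2 b2 * chi y3 b3 * chi y4 b4) \<beta>)" for \<beta>
  define I where "I \<beta> = restrict (\<lambda>x. \<beta> (fst x)) ?X" for \<beta> :: "'e edge \<Rightarrow> bool"
  define J where "J Y = restrict (\<lambda>e. Y (e, False)) (all_edges G)" for Y :: "'e edge \<times> bool \<Rightarrow> bool"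
  have vert: "(\<Prod>v\<in>?V. 8 * weight G v (x (end_at G v 1)) (x (end_at G v 2))
        (x (end_at G v 3)) (x (end_at G v 4))) =
      (\<Sum>Y\<in>?X \<rightarrow>\<^sub>E UNIV. wt Y * (\<Prod>z\<in>?X. chi (Y z) (x z)))" for x
  proof -
    have "(\<Prod>v\<in>?V. 8 * weight G v (x (end_at G v 1)) (x (end_at G v 2))
        (x (end_at G v 3)) (x (end_at G v 4))) =
      (\<Prod>v\<in>?V. \<Sum>y1\<in>UNIV. \<Sum>y2\<in>UNIV. \<Sum>y3\<in>UNIV. \<Sum>y4\<in>UNIV. ?g v y1 y2 y3 y4 *
         (chi y1 (x (end_at G v 1)) * chi y2 (x (end_at G v 2)) *
          chi y3 (x (end_at G v 3)) * chi y4 (x (end_at G v 4))))"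
    proof (rule prod.cong[OF refl], goal_cases)
      case (1 v)
      obtain a b c d where "p v = (a, b, c, d)" by (cases "p v") auto
      then show ?case
        using w[OF 1] by (simp only: eight_vertex_fourier spectrum_def prod.case)
    qed
    also have "\<dots> = (\<Sum>Y\<in>?X \<rightarrow>\<^sub>E UNIV. \<Prod>v\<in>?V. ?g v (Y (end_at G v 1)) (Y (end_at G v 2))
         (Y (end_at G v 3)) (Y (end_at G v 4)) *
         (chi (Y (end_at G v 1)) (x (end_at G v 1)) * chi (Y (end_at G v 2)) (x (end_at G v 2)) *
          chi (Y (end_at G v 3)) (x (end_at G v 3)) * chi (Y (end_at G v 4)) (x (end_at G v 4))))"
      by (rule prod_sum_vertices[OF G])
    also have "\<dots> = (\<Sum>Y\<in>?X \<rightarrow>\<^sub>E UNIV. wt Y * (\<Prod>z\<in>?X. chi (Y z) (x z)))"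
      unfolding wt_def prod_over_vertices[OF G, symmetric] prod_1_4 prod.distrib ..
    finally show ?thesis .
  qed
  have edge: "(\<Sum>\<sigma>\<in>?E \<rightarrow>\<^sub>E UNIV. \<Prod>z\<in>?X. chi (Y z) (end_bit \<sigma> ?b z)) =
      (\<Prod>e\<in>?E. if Y (Internal e, False) = Y (Internal e, True)
        then 2 * edge_sign (Y (Internal e, False)) else 0) * bd Y" for Y
  proof -
    have "(\<Sum>\<sigma>\<in>?E \<rightarrow>\<^sub>E UNIV. \<Prod>z\<in>?X. chi (Y z) (end_bit \<sigma> ?b z)) =
        (\<Sum>\<sigma>\<in>?E \<rightarrow>\<^sub>E UNIV. (\<Prod>e\<in>?E. chi (Y (Internal e, False)) (\<sigma> e) *
          chi (Y (Internal e, True)) (\<not> \<sigma> e)) * bd Y)"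
      unfolding prod_edge_ends[OF G] bd_def by simp
    also have "\<dots> = (\<Prod>e\<in>?E. \<Sum>s\<in>UNIV. chi (Y (Internal e, False)) s *
          chi (Y (Internal e, True)) (\<not> s)) * bd Y"
      unfolding sum_distrib_right[symmetric] using fin by (subst prod_sum_PiE) auto
    also have "\<dots> = (\<Prod>e\<in>?E. if Y (Internal e, False) = Y (Internal e, True)
        then 2 * edge_sign (Y (Internal e, False)) else 0) * bd Y"
      by (intro arg_cong2[where f = "(*)"] prod.cong refl)
        (auto simp: UNIV_bool chi_def edge_sign_def)
    finally show ?thesis .
  qed
  \<comment> \<open>The assignments that survive the sum over orientations. They are determined by
    one bit per edge, read at its start, which is how \<open>J\<close> turns them into
    colourings.\<close>
  let ?C = "{Y \<in> ?X \<rightarrow>\<^sub>E UNIV. \<forall>e\<in>?E. Y (Internal e, False) = Y (Internal e, True)}"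
  have "8 ^ card ?V * constraint_function G b1 b2 b3 b4 =
      (\<Sum>\<sigma>\<in>?E \<rightarrow>\<^sub>E UNIV. \<Sum>Y\<in>?X \<rightarrow>\<^sub>E UNIV. wt Y * (\<Prod>z\<in>?X. chi (Y z) (end_bit \<sigma> ?b z)))"
    unfolding vert[symmetric] constraint_function_def Let_def
    by (simp add: sum_distrib_left prod.distrib)
  also have "\<dots> = (\<Sum>Y\<in>?X \<rightarrow>\<^sub>E UNIV. wt Y * (\<Sum>\<sigma>\<in>?E \<rightarrow>\<^sub>E UNIV. \<Prod>z\<in>?X. chi (Y z) (end_bit \<sigma> ?b z)))"
    by (subst sum.swap) (simp only: sum_distrib_left)
  also have "\<dots> = (\<Sum>Y\<in>?C. wt Y * ((\<Prod>e\<in>?E. 2 * edge_sign (Y (Internal e, False))) * bd Y))"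
    unfolding edge
  proof (rule sum.mono_neutral_cong_right)
    show "finite (?X \<rightarrow>\<^sub>E (UNIV :: bool set))"
      using finite_edge_ends[OF G] by (auto intro: finite_PiE)
    show "?C \<subseteq> ?X \<rightarrow>\<^sub>E UNIV" by blast
  next
    show "\<forall>Y\<in>(?X \<rightarrow>\<^sub>E UNIV) - ?C. wt Y * ((\<Prod>e\<in>?E. if Y (Internal e, False) = Y (Internal e, True)
        then 2 * edge_sign (Y (Internal e, False)) else 0) * bd Y) = 0"
    proof
      fix Y :: "'e edge \<times> bool \<Rightarrow> bool" assume "Y \<in> (?X \<rightarrow>\<^sub>E UNIV) - ?C"
      then obtain e where "e \<in> ?E" "Y (Internal e, False) \<noteq> Y (Internal e, True)" by blast
      then have "(\<Prod>e\<in>?E. if Y (Internal e, False) = Y (Internal e, True)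
        then 2 * edge_sign (Y (Internal e, False)) else 0) = 0"
        using fin by (intro prod_zero) auto
      then show "wt Y * ((\<Prod>e\<in>?E. if Y (Internal e, False) = Y (Internal e, True)
        then 2 * edge_sign (Y (Internal e, False)) else 0) * bd Y) = 0" by simp
    qed
  next
    fix Y :: "'e edge \<times> bool \<Rightarrow> bool" assume "Y \<in> ?C"
    then have "(\<Prod>e\<in>?E. if Y (Internal e, False) = Y (Internal e, True)
        then 2 * edge_sign (Y (Internal e, False)) else 0) = (\<Prod>e\<in>?E. 2 * edge_sign (Y (Internal e, False)))"
      by (intro prod.cong) auto
    then show "wt Y * ((\<Prod>e\<in>?E. if Y (Internal e, False) = Y (Internal e, True)
        then 2 * edge_sign (Y (Internal e, False)) else 0) * bd Y) =
        wt Y * ((\<Prod>e\<in>?E. 2 * edge_sign (Y (Internal e, False))) * bd Y)" by simp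
  qed
  also have "\<dots> = (\<Sum>\<beta>\<in>all_edges G \<rightarrow>\<^sub>E UNIV. summand \<beta>)"
  proof (rule sum.reindex_bij_witness[where i = I and j = J])
    fix Y :: "'e edge \<times> bool \<Rightarrow> bool" assume Y: "Y \<in> ?C"
    have eq: "J Y (fst x) = Y x" if "x \<in> ?X" for x
    proof (cases "fst x")
      case (Internal e)
      then have "e \<in> ?E" using that by (auto simp: edge_ends_def)
      then show ?thesis using Y Internal by (cases x; cases "snd x") (auto simp: J_def all_edges_def)
    next
      case (Dangling i)
      then have "i \<in> {1..4}" "snd x = False" using that by (auto simp: edge_ends_def)
      then show ?thesis using Dangling by (cases x) (auto simp: J_def all_edges_def)
    qed
    show "I (J Y) = Y"
    proof (rule ext)
      fix x
      show "I (J Y) x = Y x"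
      proof (cases "x \<in> ?X")
        case False
        then show ?thesis using Y by (cases x) (simp add: I_def PiE_def extensional_def)
      qed (simp add: I_def eq)
    qed
    have D: "J Y (Dangling i) = Y (Dangling i, False)" if "i \<in> {1..4}" for i
      using that by (auto simp: J_def all_edges_def)
    have E: "J Y (Internal e) = Y (Internal e, False)" if "e \<in> ?E" for e
      using that by (auto simp: J_def all_edges_def)
    have V: "J Y (fst (end_at G v i)) = Y (end_at G v i)" if "v \<in> ?V" "i \<in> {1..4}" for v i
      using eq end_at_in_edge_ends[OF G that] by simp
    have "(\<Prod>v\<in>?V. at_vertex G (?g v) (J Y) v) = wt Y"
      unfolding wt_def by (rule prod.cong[OF refl]) (simp add: V del: One_nat_def)
    moreover have "(\<Prod>e\<in>?E. 2 * edge_sign (J Y (Internal e))) =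
        (\<Prod>e\<in>?E. 2 * edge_sign (Y (Internal e, False)))"
      by (rule prod.cong[OF refl]) (simp add: E)
    moreover have "at_boundary (\<lambda>y1 y2 y3 y4. chi y1 b1 * chi y2 b2 * chi y3 b3 * chi y4 b4) (J Y) = bd Y"
      unfolding bd_def prod_1_4 by (simp add: D del: One_nat_def)
    ultimately show "summand (J Y) = wt Y * ((\<Prod>e\<in>?E. 2 * edge_sign (Y (Internal e, False))) * bd Y)"
      by (simp only: summand_def)
  next
    fix \<beta> :: "'e edge \<Rightarrow> bool" assume "\<beta> \<in> all_edges G \<rightarrow>\<^sub>E UNIV"
    then show "J (I \<beta>) = \<beta>"
      by (auto simp: I_def J_def fun_eq_iff PiE_def extensional_def edge_ends_def all_edges_def)
  qed (auto simp: I_def J_def edge_ends_def)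
  finally show ?thesis
    using fin by (simp add: summand_def prod.distrib sum_distrib_left mult_ac)
qed

text \<open>Detects the patterns \<open>0101\<close> and \<open>1010\<close>, in which a red and a
  green strand cross at the vertex.\<close>

definition crossing_sign :: "bool \<Rightarrow> bool \<Rightarrow> bool \<Rightarrow> bool \<Rightarrow> real" where
  "crossing_sign y1 y2 y3 y4 = (if y1 = y3 \<and> y2 = y4 \<and> y1 \<noteq> y2 then -1 else 1)"

definition ones :: "bool \<Rightarrow> bool \<Rightarrow> bool \<Rightarrow> bool \<Rightarrow> nat" where
  "ones y1 y2 y3 y4 = of_bool y1 + of_bool y2 + of_bool y3 + of_bool y4"

lemma handshake_ones:
  assumes "four_ary_construction G"
  shows "(\<Sum>v\<in>verts G. at_vertex G ones \<beta> v) =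
    2 * (\<Sum>e\<in>edges G. of_bool (\<beta> (Internal e))) + at_boundary ones \<beta>"
  using handshake[OF assms, of "\<lambda>e. of_bool (\<beta> e)"] by (simp only: sum_1_4 ones_def)

lemma even_boundary:
  assumes G: "four_ary_construction G"
    and even: "\<And>v. v \<in> verts G \<Longrightarrow> even (at_vertex G ones \<beta> v)"
  shows "even (at_boundary ones \<beta>)"
proof -
  have "even (\<Sum>v\<in>verts G. at_vertex G ones \<beta> v)" using even by (intro dvd_sum)
  then show ?thesis unfolding handshake_ones[OF G] by simp
qed

section \<open>Square roots branched along curves\<close>

text \<open>A continuous function with values in \<open>{1, -1}\<close> cannot change on a connected
  set. The geometric signs below are compared by applying this to quotients of two square roots of
  one function.\<close>

lemma square_one_constant:
  fixes f :: "'a :: topological_space \<Rightarrow> complex"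
  assumes "connected S" "continuous_on S f" "\<And>z. z \<in> S \<Longrightarrow> f z ^ 2 = 1" "x \<in> S" "y \<in> S"
  shows "f x = f y"
proof -
  have "f ` S \<subseteq> {1, -1}" using assms(3) by (auto simp: power2_eq_1_iff)
  then have "finite (f ` S)" by (rule finite_subset) simp
  then have "f constant_on S" using assms(1,2) by (intro continuous_finite_range_constant)
  then show ?thesis using assms(4,5) by (auto simp: constant_on_def)
qed

text \<open>Even for an open path, \<open>exp (2 * pi * \<i> * winding_number g z)\<close> is the
  quotient of \<open>pathfinish g - z\<close> by \<open>pathstart g - z\<close>. Halving the
  exponent gives a root of that quotient off the path, and the factor \<open>pathstart g - z\<close>
  makes it a root of the product.\<close>

definition path_root :: "(real \<Rightarrow> complex) \<Rightarrow> complex \<Rightarrow> complex" where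
  "path_root g z = exp (of_real pi * \<i> * winding_number g z) * (pathstart g - z)"

lemma path_root_square:
  assumes "path g" "z \<notin> path_image g"
  shows "path_root g z ^ 2 = (pathstart g - z) * (pathfinish g - z)"
proof -
  have "exp (of_real pi * \<i> * winding_number g z) ^ 2 = exp (2 * of_real pi * \<i> * winding_number g z)"
    by (metis exp_double mult.assoc)
  then show ?thesis
    unfolding winding_number_exp_2pi[OF assms] path_root_def power_mult_distrib
    by (simp only: power2_eq_square mult_ac of_real_mult of_real_numeral)
qed

lemma continuous_path_root:
  assumes "path g" "z \<notin> path_image g"
  shows "isCont (path_root g) z"
  unfolding path_root_def using continuous_at_winding_number[OF assms] by (intro continuous_intros)

text \<open>Winding numbers add under subdivision. The division removes the factor
  \<open>g t - z\<close> with which the root of the second piece starts.\<close>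

lemma path_root_subpath:
  assumes "path g" "z \<notin> path_image g" "t \<in> {0..1}"
  shows "path_root g z = path_root (subpath 0 t g) z * path_root (subpath t 1 g) z / (g t - z)"
proof -
  have "g t \<noteq> z" using assms(2,3) by (auto simp: path_image_def)
  moreover have "winding_number g z =
      winding_number (subpath 0 t g) z + winding_number (subpath t 1 g) z"
    using winding_number_subpath_combine[of g z 0 t 1] assms by simp
  moreover have "pathstart (subpath 0 t g) = pathstart g" "pathstart (subpath t 1 g) = g t"
    by (simp_all add: pathstart_def subpath_def)
  ultimately show ?thesis by (simp add: path_root_def distrib_left exp_add)
qed

text \<open>A branch of the square root of \<open>a - z\<close> on the disc with centre \<open>z0\<close> whose boundary contains \<open>a\<close>.\<close>

definition disc_root :: "complex \<Rightarrow> complex \<Rightarrow> complex \<Rightarrow> complex" where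
  "disc_root z0 a z = csqrt (a - z0) * csqrt (1 - (z - z0) / (a - z0))"

lemma disc_root_square: "a \<noteq> z0 \<Longrightarrow> disc_root z0 a z ^ 2 = a - z"
  by (simp add: disc_root_def power_mult_distrib field_simps)

text \<open>Keeps arguments of \<open>csqrt\<close> off its branch cut: the closed unit disc,
  punctured at 1, lies in the half-plane \<open>Re w < 1\<close>.\<close>

lemma one_minus_notin_nonpos_Reals:
  fixes w :: complex
  assumes "norm w \<le> 1" "w \<noteq> 1"
  shows "1 - w \<notin> \<real>\<^sub>\<le>\<^sub>0" "0 < Re (1 - w)"
proof -
  show "0 < Re (1 - w)"
  proof (rule ccontr)
    assume "\<not> 0 < Re (1 - w)"
    then have "1 \<le> Re w" by simp
    moreover have "Re w \<le> norm w" by (rule complex_Re_le_cmod)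
    ultimately have "Re w = norm w" "norm w = 1" using assms(1) by linarith+
    then have "Re w = 1" "Im w = 0" using cmod_power2[of w] by simp_all
    then have "w = 1" by (simp add: complex_eq_iff)
    with assms(2) show False by simp
  qed
  then show "1 - w \<notin> \<real>\<^sub>\<le>\<^sub>0" by (auto simp: complex_nonpos_Reals_iff)
qed

lemma continuous_disc_root:
  assumes "dist z0 a = r" "0 < r" "z \<in> cball z0 r" "z \<noteq> a"
  shows "isCont (disc_root z0 a) z"
proof -
  have "a \<noteq> z0" using assms(1,2) by auto
  moreover have "norm ((z - z0) / (a - z0)) \<le> 1"
    using assms by (auto simp: norm_divide dist_norm norm_minus_commute divide_simps)
  moreover have "(z - z0) / (a - z0) \<noteq> 1"
    using assms(4) calculation(1) by (simp add: field_simps)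
  ultimately show ?thesis
    unfolding disc_root_def
    by (intro continuous_intros isCont_csqrt' one_minus_notin_nonpos_Reals) auto
qed

section \<open>Comparison of inner and outer branches on a circle\<close>

lemma one_minus_cis: "1 - cis (2 * \<delta>) = of_real (sin \<delta>) * (- 2 * \<i> * cis \<delta>)"
  by (rule complex_eqI) (simp_all add: cos_double_sin sin_double power2_eq_square)

lemma sin_half:
  fixes \<delta> :: real
  assumes "0 < \<bar>\<delta>\<bar>" "\<bar>\<delta>\<bar> < 2 * pi"
  shows "sgn (sin (\<delta> / 2)) = sgn \<delta>" "sin (\<delta> / 2) \<noteq> 0"
proof -
  have "0 < sin (\<delta> / 2)" if "0 < \<delta>" using sin_gt_zero[of "\<delta> / 2"] assms that by simp
  moreover have "sin (\<delta> / 2) < 0" if "\<delta> < 0" using sin_gt_zero[of "- (\<delta> / 2)"] assms that by simp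
  moreover have "0 < \<delta> \<or> \<delta> < 0" using assms by auto
  ultimately show "sgn (sin (\<delta> / 2)) = sgn \<delta>" "sin (\<delta> / 2) \<noteq> 0" by (auto simp: sgn_if)
qed

lemma cis_neq_1:
  assumes "0 < \<bar>\<delta>\<bar>" "\<bar>\<delta>\<bar> < 2 * pi"
  shows "cis \<delta> \<noteq> 1"
  using one_minus_cis[of "\<delta> / 2"] sin_half(2)[OF assms] by auto

text \<open>The two arguments of \<open>csqrt\<close> are conjugate, hence so are their principal
  roots, and a root divided by its conjugate is the direction \<open>u / norm u\<close> of its
  square \<open>u\<close>. By the half-angle formula this direction is
  \<open>- \<i> * cis \<delta>\<close> times the sign of \<open>sin \<delta>\<close>, where
  \<open>\<delta>\<close> is half the angle difference; this is the source of the jump at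
  \<open>x = \<alpha>\<close>.\<close>

lemma csqrt_quotient_cis:
  assumes "0 < \<bar>x - \<alpha>\<bar>" "\<bar>x - \<alpha>\<bar> < 2 * pi"
  shows "csqrt (1 - cis (\<alpha> - x)) =
    of_real (sgn (x - \<alpha>)) * (\<i> * cis (- x / 2) * cis (\<alpha> / 2)) * csqrt (1 - cis (x - \<alpha>))"
proof -
  define \<delta> where "\<delta> = (\<alpha> - x) / 2"
  define u where "u = 1 - cis (\<alpha> - x)"
  have sin: "sin \<delta> \<noteq> 0" "sgn (sin \<delta>) = - sgn (x - \<alpha>)"
    using sin_half[of "\<alpha> - x"] assms by (auto simp: \<delta>_def sgn_if)
  have u: "u = of_real (sin \<delta>) * (- 2 * \<i> * cis \<delta>)"
  proof -
    have "2 * \<delta> = \<alpha> - x" by (simp add: \<delta>_def)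
    then show ?thesis using one_minus_cis[of \<delta>] by (simp only: u_def)
  qed
  have "u \<noteq> 0" using sin(1) by (simp add: u)
  have "u \<notin> \<real>\<^sub>\<le>\<^sub>0" unfolding u_def
    using cis_neq_1[of "\<alpha> - x"] assms by (intro one_minus_notin_nonpos_Reals) auto
  then have cnj: "csqrt (1 - cis (x - \<alpha>)) = cnj (csqrt u)"
    by (simp add: cnj_csqrt u_def cis_cnj)
  have "csqrt u / cnj (csqrt u) = csqrt u ^ 2 / of_real (norm (csqrt u) ^ 2)"
    using \<open>u \<noteq> 0\<close> by (simp only: complex_norm_square) (simp add: power2_eq_square)
  also have "\<dots> = u / of_real (norm u)"
    by (simp flip: norm_power)
  also have "norm u = 2 * \<bar>sin \<delta>\<bar>" by (simp add: u norm_mult)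
  also have "u / of_real (2 * \<bar>sin \<delta>\<bar>) = of_real (sgn (sin \<delta>)) * (- \<i> * cis \<delta>)"
    using sin(1) by (simp add: u sgn_if abs_if)
  also have "cis \<delta> = cis (- x / 2) * cis (\<alpha> / 2)"
    by (simp add: \<delta>_def cis_mult diff_divide_distrib)
  finally have "csqrt u = of_real (sgn (x - \<alpha>)) * (\<i> * cis (- x / 2) * cis (\<alpha> / 2)) * cnj (csqrt u)"
    using \<open>u \<noteq> 0\<close> by (simp add: sin(2) field_simps)
  then show ?thesis unfolding cnj by (simp only: u_def)
qed

text \<open>Any set between a connected set and its closure is connected; here the connected set is
  the open exterior of the disc.\<close>

lemma connected_exterior:
  fixes z0 :: complex
  assumes "0 < r" "S \<subseteq> sphere z0 r"
  shows "connected {z. r \<le> dist z0 z \<and> z \<notin> S}"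
proof (rule connected_intermediate_closure)
  show "connected (- cball z0 r)"
    by (rule connected_complement_bounded_convex) auto
  show "- cball z0 r \<subseteq> {z. r \<le> dist z0 z \<and> z \<notin> S}" using assms by auto
  show "{z. r \<le> dist z0 z \<and> z \<notin> S} \<subseteq> closure (- cball z0 r)"
    using assms(1) by (auto simp: closure_complement)
qed

text \<open>
  Outside the disc, \<open>K\<close> agrees up to a constant sign with the branch
  \<open>(z - z0)^(card I / 2) * (\<Prod>i. csqrt (1 - (p i - z0) / (z - z0)))\<close>, which on the boundary
  circle can be compared with the branch \<open>\<Prod>i. disc_root z0 (p i) z\<close> that extends into the disc.
  Passing a point \<open>p i\<close> on the circle changes the sign of their quotient.
\<close>

lemma boundary_sign:
  fixes I :: "'i set" and \<theta> :: "'i \<Rightarrow> real"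
  assumes I: "finite I" "even (card I)" and r: "0 < r"
    and p: "\<And>i. i \<in> I \<Longrightarrow> p i = z0 + of_real r * cis (\<theta> i)"
    and S: "S \<subseteq> cball z0 r" "S \<inter> sphere z0 r \<subseteq> p ` I"
    and K: "\<And>z. z \<notin> S \<Longrightarrow> isCont K z" "\<And>z. z \<notin> S \<Longrightarrow> K z ^ 2 = (\<Prod>i\<in>I. p i - z)"
  shows "\<exists>\<kappa>. \<forall>x. (\<forall>i\<in>I. 0 < \<bar>x - \<theta> i\<bar> \<and> \<bar>x - \<theta> i\<bar> < 2 * pi) \<longrightarrow>
    K (z0 + of_real r * cis x) =
    \<kappa> * (\<Prod>i\<in>I. of_real (sgn (x - \<theta> i))) * (\<Prod>i\<in>I. disc_root z0 (p i) (z0 + of_real r * cis x))"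
proof -
  obtain m where m: "card I = 2 * m" using I(2) by (elim evenE)
  define X where "X = {z. r \<le> dist z0 z \<and> z \<notin> p ` I}"
  define E where "E z = (z - z0) ^ m * (\<Prod>i\<in>I. csqrt (1 - (p i - z0) / (z - z0)))" for z
  have sph: "dist z0 (p i) = r" if "i \<in> I" for i
    using p[OF that] r by (simp add: dist_norm norm_mult)
  have conn: "connected X"
    unfolding X_def by (rule connected_exterior[OF r]) (use sph in auto)
  have XS: "z \<notin> S" if "z \<in> X" for z
  proof
    assume "z \<in> S"
    then have "z \<in> S \<inter> sphere z0 r" using S(1) that by (force simp: X_def)
    then show False using S(2) that by (auto simp: X_def)
  qed
  have quot: "1 - (p i - z0) / (z - z0) \<notin> \<real>\<^sub>\<le>\<^sub>0" if "i \<in> I" "z \<in> X" for i z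
  proof (rule one_minus_notin_nonpos_Reals)
    have "z \<noteq> z0" "z \<noteq> p i" "r \<le> norm (z - z0)"
      using that r by (auto simp: X_def dist_norm norm_minus_commute)
    then show "norm ((p i - z0) / (z - z0)) \<le> 1" "(p i - z0) / (z - z0) \<noteq> 1"
      using sph[OF that(1)] r by (auto simp: norm_divide dist_norm norm_minus_commute field_simps)
  qed
  have E: "isCont E z" "E z ^ 2 = (\<Prod>i\<in>I. p i - z)" "E z \<noteq> 0" if z: "z \<in> X" for z
  proof -
    have ne: "z - z0 \<noteq> 0" using z r by (auto simp: X_def)
    show "isCont E z" unfolding E_def using quot[OF _ z] ne
      by (intro continuous_intros isCont_csqrt') auto
    have "E z ^ 2 = (z - z0) ^ card I * (\<Prod>i\<in>I. 1 - (p i - z0) / (z - z0))"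
      by (simp add: E_def m power_mult_distrib prod_power_distrib mult.commute flip: power_mult)
    also have "\<dots> = (\<Prod>i\<in>I. (z - z0) * (1 - (p i - z0) / (z - z0)))"
      by (simp add: prod.distrib)
    also have "\<dots> = (\<Prod>i\<in>I. - 1 * (p i - z))"
      by (intro prod.cong refl) (use ne in \<open>simp add: field_simps\<close>)
    \<comment> \<open>The factors \<open>-1\<close> cancel because \<open>card I\<close> is
      even.\<close>
    also have "\<dots> = (\<Prod>i\<in>I. p i - z)"
      using I(2) by (simp only: prod.distrib prod_constant) simp
    finally show "E z ^ 2 = (\<Prod>i\<in>I. p i - z)" .
    moreover have "(\<Prod>i\<in>I. p i - z) \<noteq> 0" using z I(1) by (auto simp: X_def)
    ultimately show "E z \<noteq> 0" by auto
  qed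
  define y where "y = z0 + of_real (2 * r)"
  have y: "y \<in> X"
  proof -
    have "dist z0 y = 2 * r" using r by (simp add: y_def dist_norm norm_mult)
    then show ?thesis using r sph by (force simp: X_def)
  qed
  \<comment> \<open>The sign between \<open>K\<close> and \<open>E\<close>; it is the same on all of
    the connected set \<open>X\<close>, so it can be read at the single point
    \<open>y\<close>.\<close>
  define \<epsilon> where "\<epsilon> = K y / E y"
  have \<epsilon>: "K z = \<epsilon> * E z" if z: "z \<in> X" for z
  proof -
    have "K z / E z = K y / E y"
    proof (rule square_one_constant[OF conn _ _ z y])
      show "continuous_on X (\<lambda>z. K z / E z)"
        using K(1) XS E by (intro continuous_at_imp_continuous_on ballI continuous_intros) auto
      show "(K w / E w) ^ 2 = 1" if "w \<in> X" for w
        using E[OF that] K(2)[OF XS[OF that]] by (simp add: power_divide) (metis power_not_zero)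
    qed
    then show ?thesis using E(3)[OF z] by (simp add: \<epsilon>_def field_simps)
  qed
  define \<kappa> where "\<kappa> = \<epsilon> * of_real r ^ m * (\<Prod>i\<in>I. \<i> * cis (\<theta> i / 2) / csqrt (p i - z0))"
  have "K c = \<kappa> * (\<Prod>i\<in>I. of_real (sgn (x - \<theta> i))) * (\<Prod>i\<in>I. disc_root z0 (p i) c)"
    if x: "\<forall>i\<in>I. 0 < \<bar>x - \<theta> i\<bar> \<and> \<bar>x - \<theta> i\<bar> < 2 * pi" and c: "c = z0 + of_real r * cis x" for x c
  proof -
    have cis: "(p i - z0) / (c - z0) = cis (\<theta> i - x)" "(c - z0) / (p i - z0) = cis (x - \<theta> i)"
      if "i \<in> I" for i
      using p[OF that] r by (simp_all add: c cis_divide)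
    have "c \<in> X"
    proof -
      have "c \<noteq> p i" if "i \<in> I" for i
        using cis(1)[OF that] cis_neq_1[of "\<theta> i - x"] x that r sph[OF that] by fastforce
      then show ?thesis using r by (auto simp: X_def c dist_norm norm_mult)
    qed
    have fac: "csqrt (1 - (p i - z0) / (c - z0)) = cis (- x / 2) * (of_real (sgn (x - \<theta> i)) *
        disc_root z0 (p i) c * (\<i> * cis (\<theta> i / 2) / csqrt (p i - z0)))" if i: "i \<in> I" for i
    proof -
      have "csqrt (p i - z0) \<noteq> 0" using sph[OF i] r by auto
      then show ?thesis
        using csqrt_quotient_cis[of x "\<theta> i"] x i by (simp add: cis[OF i] disc_root_def)
    qed
    \<comment> \<open>The rotating factor \<open>cis x ^ m\<close> of \<open>E\<close> cancels
      against the factors \<open>cis (- x / 2)\<close> of the \<open>2 * m\<close> roots, so that,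
      apart from the inner branch, only the signs vary with \<open>x\<close>.\<close>
    have "cis x * (cis (- x / 2) * cis (- x / 2)) = 1" by (simp add: cis_mult)
    then have one: "cis x ^ m * cis (- x / 2) ^ (2 * m) = 1"
      by (simp only: power_mult power2_eq_square flip: power_mult_distrib) simp
    have "E c = of_real r ^ m * (cis x ^ m * cis (- x / 2) ^ (2 * m)) *
        ((\<Prod>i\<in>I. of_real (sgn (x - \<theta> i))) * (\<Prod>i\<in>I. disc_root z0 (p i) c) *
        (\<Prod>i\<in>I. \<i> * cis (\<theta> i / 2) / csqrt (p i - z0)))"
      unfolding E_def by (simp only: fac prod.distrib prod_constant m cong: prod.cong)
        (simp add: c power_mult_distrib)
    then show ?thesis unfolding \<epsilon>[OF \<open>c \<in> X\<close>] one by (simp add: \<kappa>_def)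
  qed
  then show ?thesis by blast
qed

text \<open>
  Near \<open>z0\<close>, the initial pieces of the curves up to the circle determine the sign of the quotient
  of the left-hand side of \<open>\<psi>\<close> by a function continuous at \<open>z0\<close>; \<open>L\<close> collects the other factors.
\<close>

lemma vertex_sign:
  fixes g :: "'i \<Rightarrow> real \<Rightarrow> complex" and \<theta> :: "'i \<Rightarrow> real"
  assumes I: "finite J" "I \<subseteq> J" "even (card I)"
    and g: "\<And>i. i \<in> J \<Longrightarrow> path (g i)" "\<And>i. i \<in> J \<Longrightarrow> pathstart (g i) = z0"
      "\<And>i t. \<lbrakk>i \<in> J; t \<in> {0<..1}\<rbrakk> \<Longrightarrow> g i t \<noteq> z0"
    and r: "0 < r"
    and p: "\<And>i. i \<in> J \<Longrightarrow> p i = z0 + of_real r * cis (\<theta> i)"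
    and \<theta>: "\<And>i k. \<lbrakk>i \<in> I; k \<in> J - I\<rbrakk> \<Longrightarrow> 0 < \<bar>\<theta> k - \<theta> i\<bar> \<and> \<bar>\<theta> k - \<theta> i\<bar> < 2 * pi"
    and hit: "\<And>i. i \<in> J \<Longrightarrow> first_hit (g i) z0 r (p i)"
    and disj: "\<And>i k. \<lbrakk>i \<in> I; k \<in> J - I\<rbrakk> \<Longrightarrow> g i ` {0<..1} \<inter> g k ` {0<..1} = {}"
    and L: "isCont L z0"
    and \<psi>: "\<And>k t. \<lbrakk>k \<in> J - I; t \<in> {0<..1}\<rbrakk> \<Longrightarrow>
      (\<Prod>i\<in>I. path_root (g i) (g k t)) / (z0 - g k t) ^ (card I div 2) * L (g k t) = \<psi> k"
  shows "\<exists>\<kappa>. \<forall>k\<in>J - I. \<psi> k = \<kappa> * (\<Prod>i\<in>I. of_real (sgn (\<theta> k - \<theta> i)))"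
proof -
  define m where "m = card I div 2"
  have m: "card I = 2 * m" using I(3) by (simp add: m_def)
  have finI: "finite I" using I(1,2) by (rule finite_subset[rotated])
  have IJ: "i \<in> J" if "i \<in> I" for i using I(2) that by blast
  have g0: "g i 0 = z0" if "i \<in> J" for i using g(2)[OF that] by (simp add: pathstart_def)
  \<comment> \<open>\<open>h i\<close> is the time of the first hit, at which the curve is cut into
    an initial piece inside the disc and a remainder.\<close>
  obtain h where h: "\<And>i. i \<in> J \<Longrightarrow> h i \<in> {0..1} \<and> g i (h i) = p i \<and> dist z0 (p i) = r \<and>
      (\<forall>s\<in>{0..<h i}. dist z0 (g i s) < r)"
    using hit unfolding first_hit_def by metis
  have h0: "h i \<in> {0<..1}" if "i \<in> J" for i
    using h[OF that] g0[OF that] r by (cases "h i = 0") auto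
  have pz: "p i \<noteq> z0" if "i \<in> J" for i using h[OF that] r by auto
  define S where "S = (\<Union>i\<in>I. g i ` {0..h i})"
  \<comment> \<open>\<open>K\<close> is the root along the initial pieces, \<open>M\<close> a root
    of the same function that extends over the inside of the disc, and \<open>N\<close> the
    contribution of the remainders, which stay away from \<open>z0\<close>.\<close>
  define K where "K z = (\<Prod>i\<in>I. path_root (subpath 0 (h i) (g i)) z) / (z0 - z) ^ m" for z
  define M where "M z = (\<Prod>i\<in>I. disc_root z0 (p i) z)" for z
  define N where "N z = (\<Prod>i\<in>I. path_root (subpath (h i) 1 (g i)) z / (p i - z))" for z
  have sub: "path (subpath 0 (h i) (g i))" "path_image (subpath 0 (h i) (g i)) \<subseteq> S"
    "pathstart (subpath 0 (h i) (g i)) = z0" "pathfinish (subpath 0 (h i) (g i)) = p i"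
    if i: "i \<in> I" for i
    using h[OF IJ[OF i]] g0[OF IJ[OF i]] g(1)[OF IJ[OF i]] i
    by (auto simp: path_image_subpath S_def)
  have z0: "z0 \<in> S" if "m \<noteq> 0"
  proof -
    obtain i where "i \<in> I" using m \<open>m \<noteq> 0\<close> by fastforce
    then show ?thesis using g0[OF IJ] h[OF IJ] by (force simp: S_def)
  qed
  have S: "S \<subseteq> cball z0 r" "S \<inter> sphere z0 r \<subseteq> p ` I"
  proof -
    have "dist z0 (g i s) \<le> r \<and> (dist z0 (g i s) = r \<longrightarrow> g i s = p i)" if "i \<in> I" "s \<in> {0..h i}" for i s
      using h[OF IJ[OF that(1)]] that(2) by (cases "s = h i") force+
    note piece = this
    show "S \<subseteq> cball z0 r" using piece by (auto simp: S_def)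
    show "S \<inter> sphere z0 r \<subseteq> p ` I"
    proof
      fix z assume "z \<in> S \<inter> sphere z0 r"
      then obtain i s where "i \<in> I" "s \<in> {0..h i}" "z = g i s" "dist z0 z = r"
        by (auto simp: S_def)
      then show "z \<in> p ` I" using piece[of i s] by auto
    qed
  qed
  have K: "isCont K z" "K z ^ 2 = (\<Prod>i\<in>I. p i - z)" if z: "z \<notin> S" for z
  proof -
    have ne: "(z0 - z) ^ m \<noteq> 0" using z0 z by auto
    have off: "z \<notin> path_image (subpath 0 (h i) (g i))" if "i \<in> I" for i
      using sub(2)[OF that] z by blast
    show "isCont K z" unfolding K_def using ne off sub(1)
      by (intro continuous_intros continuous_path_root) auto
    have "K z ^ 2 = (\<Prod>i\<in>I. (z0 - z) * (p i - z)) / (z0 - z) ^ card I"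
      using sub off by (simp add: K_def m power_divide path_root_square mult.commute prod_power_distrib flip: power_mult)
    also have "\<dots> = (\<Prod>i\<in>I. p i - z)"
      using ne by (simp add: prod.distrib m power_mult)
    finally show "K z ^ 2 = (\<Prod>i\<in>I. p i - z)" .
  qed
  obtain \<kappa> where \<kappa>: "\<And>x. (\<And>i. i \<in> I \<Longrightarrow> 0 < \<bar>x - \<theta> i\<bar> \<and> \<bar>x - \<theta> i\<bar> < 2 * pi) \<Longrightarrow>
      K (z0 + of_real r * cis x) =
      \<kappa> * (\<Prod>i\<in>I. of_real (sgn (x - \<theta> i))) * M (z0 + of_real r * cis x)"
    using boundary_sign[OF finI I(3) r p[OF IJ] S K] unfolding M_def by blast
  have M: "M z \<noteq> 0" "isCont M z" "M z ^ 2 = (\<Prod>i\<in>I. p i - z)" if z: "z \<in> cball z0 r - p ` I" for z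
  proof -
    show "isCont M z" unfolding M_def
      using z r h[OF IJ] by (intro continuous_intros continuous_disc_root) auto
    show sq: "M z ^ 2 = (\<Prod>i\<in>I. p i - z)"
      unfolding M_def prod_power_distrib using pz IJ by (intro prod.cong refl disc_root_square) auto
    have "(\<Prod>i\<in>I. p i - z) \<noteq> 0" using z finI by auto
    then show "M z \<noteq> 0" using sq by auto
  qed
  \<comment> \<open>The value at \<open>z0\<close> of all factors that are continuous there; it does
    not depend on \<open>k\<close>, so \<open>\<kappa> * C\<close> is the constant sought.\<close>
  define C where "C = M z0 * N z0 * L z0"
  have "\<psi> k = \<kappa> * C * (\<Prod>i\<in>I. of_real (sgn (\<theta> k - \<theta> i)))" if k: "k \<in> J - I" for k
  proof -
    let ?s = "\<Prod>i\<in>I. of_real (sgn (\<theta> k - \<theta> i)) :: complex"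
    let ?A = "g k ` {0<..h k}"
    have kJ: "k \<in> J" using k by simp
    have contg: "continuous_on {0..1} (g k)" using g(1)[OF kJ] by (simp add: path_def)
    have arc: "g k t \<notin> g i ` {0..1}" if "t \<in> {0<..1}" "i \<in> I" for t i
    proof
      assume "g k t \<in> g i ` {0..1}"
      then obtain s where s: "s \<in> {0..1}" "g k t = g i s" by blast
      show False
      proof (cases "s = 0")
        case True
        then show False using s g0[OF IJ[OF that(2)]] g(3)[OF kJ that(1)] by simp
      next
        case False
        then have "g i s \<in> g i ` {0<..1}" using s(1) by auto
        moreover have "g i s \<in> g k ` {0<..1}" unfolding s(2)[symmetric] using that(1) by blast
        ultimately show False using disj[OF that(2) k] by blast
      qed
    qed
    have AS: "z \<notin> S" and AD: "z \<in> cball z0 r - p ` I" if z: "z \<in> ?A" for z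
    proof -
      obtain t where t: "t \<in> {0<..h k}" "z = g k t" using z by blast
      have t1: "t \<in> {0<..1}" using t(1) h0[OF kJ] by auto
      have sub: "g i ` {0..h i} \<subseteq> g i ` {0..1}" if "i \<in> I" for i
        using h[OF IJ[OF that]] by (intro image_mono) auto
      show "z \<notin> S" using arc[OF t1] sub t(2) by (fastforce simp: S_def)
      have "dist z0 z \<le> r"
        using h[OF kJ] t by (cases "t = h k") (auto simp: less_imp_le)
      moreover have "z \<noteq> p i" if "i \<in> I" for i
        using arc[OF t1 that] t(2) h[OF IJ[OF that]] by (metis image_eqI)
      ultimately show "z \<in> cball z0 r - p ` I" by auto
    qed
    \<comment> \<open>On the part of the curve \<open>k\<close> up to the circle,
      \<open>K / M\<close> is continuous with square 1. Its value at the exit point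
      \<open>p k\<close>, known from \<open>\<kappa>\<close>, therefore persists all the way towards
      \<open>z0\<close>.\<close>
    have KM: "K z = \<kappa> * ?s * M z" if z: "z \<in> ?A" for z
    proof -
      have pk: "p k \<in> ?A" using h[OF kJ] h0[OF kJ] by force
      have "K z / M z = K (p k) / M (p k)"
      proof (rule square_one_constant[OF _ _ _ z pk])
        have "continuous_on {0<..h k} (g k)"
          using h0[OF kJ] by (intro continuous_on_subset[OF contg]) auto
        then show "connected ?A" by (intro connected_continuous_image) auto
        show "continuous_on ?A (\<lambda>z. K z / M z)"
          using K(1)[OF AS] M(1,2)[OF AD]
          by (intro continuous_at_imp_continuous_on ballI continuous_intros) auto
        show "(K w / M w) ^ 2 = 1" if "w \<in> ?A" for w
          using K(2)[OF AS[OF that]] M[OF AD[OF that]] by (simp add: power_divide) (metis power_not_zero)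
      qed
      moreover have "K (p k) = \<kappa> * ?s * M (p k)"
        using \<kappa>[of "\<theta> k"] \<theta>[OF _ k] by (simp add: p[OF kJ])
      ultimately show ?thesis using M(1)[OF AD[OF pk]] M(1)[OF AD[OF z]] by (simp add: field_simps)
    qed
    have eq: "\<psi> k = \<kappa> * ?s * (M (g k t) * N (g k t) * L (g k t))" if t: "t \<in> {0<..h k}" for t
    proof -
      have t1: "t \<in> {0<..1}" using t h0[OF kJ] by auto
      have "path_root (g i) (g k t) = path_root (subpath 0 (h i) (g i)) (g k t) *
          (path_root (subpath (h i) 1 (g i)) (g k t) / (p i - g k t))" if "i \<in> I" for i
        using path_root_subpath[of "g i" "g k t" "h i"] arc[OF t1 that] g(1)[OF IJ[OF that]] h[OF IJ[OF that]]
        by (simp add: path_image_def)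
      then have "(\<Prod>i\<in>I. path_root (g i) (g k t)) / (z0 - g k t) ^ m = K (g k t) * N (g k t)"
        by (simp add: K_def N_def flip: prod.distrib)
      then show ?thesis
        using \<psi>[OF k t1] KM[of "g k t"] t by (simp add: m_def mult.assoc)
    qed
    have "isCont N z0"
    proof -
      have "z0 \<notin> path_image (subpath (h i) 1 (g i))" if i: "i \<in> I" for i
      proof
        assume "z0 \<in> path_image (subpath (h i) 1 (g i))"
        then obtain s where "s \<in> {h i..1}" "g i s = z0"
          using h0[OF IJ[OF i]] by (auto simp: path_image_subpath)
        then show False using g(3)[OF IJ[OF i], of s] h0[OF IJ[OF i]] by auto
      qed
      moreover have "path (subpath (h i) 1 (g i))" if "i \<in> I" for i
        using h[OF IJ[OF that]] g(1)[OF IJ[OF that]] by (intro path_subpath) auto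
      ultimately show ?thesis
        unfolding N_def using pz IJ by (intro continuous_intros continuous_path_root) auto
    qed
    moreover have "isCont M z0"
      unfolding M_def using r h[OF IJ] pz[OF IJ] by (intro continuous_intros continuous_disc_root) auto
    ultimately have cont: "isCont (\<lambda>z. \<kappa> * ?s * (M z * N z * L z)) z0"
      using L by (intro continuous_intros) auto
    have lim: "(g k \<longlongrightarrow> z0) (at_right 0)"
      using contg g0[OF kJ] by (auto simp: continuous_on_def simp flip: at_within_Icc_at_right[of 0 1])
    have "((\<lambda>t. \<kappa> * ?s * (M (g k t) * N (g k t) * L (g k t))) \<longlongrightarrow> \<kappa> * ?s * (M z0 * N z0 * L z0)) (at_right 0)"
      by (rule isCont_tendsto_compose[OF cont lim])
    moreover have "eventually (\<lambda>t. \<kappa> * ?s * (M (g k t) * N (g k t) * L (g k t)) = \<psi> k) (at_right 0)"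
      unfolding eventually_at_right_field using eq[symmetric] h0[OF kJ] by (intro exI[of _ "h k"]) auto
    ultimately have "((\<lambda>t. \<psi> k) \<longlongrightarrow> \<kappa> * ?s * (M z0 * N z0 * L z0)) (at_right (0::real))"
      by (rule Lim_transform_eventually)
    then have "\<psi> k = \<kappa> * ?s * (M z0 * N z0 * L z0)"
      by (intro tendsto_unique[OF _ tendsto_const]) auto
    then show ?thesis by (simp add: C_def)
  qed
  then show ?thesis by blast
qed

section \<open>Parity of crossings in a plane drawing\<close>

lemma card_filter_1_4: "card {i \<in> {1..4::nat}. P i} = ones (P 1) (P 2) (P 3) (P 4)"
proof -
  have "card {i \<in> {1..4::nat}. P i} = (\<Sum>i\<in>{1..4}. of_bool (P i))"
    by (simp only: card_eq_sum sum.inter_filter[OF finite_atLeastAtMost] of_bool_def)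
  then show ?thesis by (simp only: sum_1_4 ones_def)
qed

text \<open>If some label is green, \<open>\<kappa>\<close> is 1 or -1, and it occurs once for each
  green label, an even number of times. With two red labels the signs
  \<open>sgn (\<theta> k - \<theta> i)\<close> multiply to -1 exactly when red and green alternate;
  with none or four there are no signs at all.\<close>

lemma alternating_sign_product:
  fixes \<theta> :: "nat \<Rightarrow> real" and \<psi> :: "nat \<Rightarrow> complex" and \<rho> :: "nat \<Rightarrow> bool"
  defines "I \<equiv> {i \<in> {1..4}. \<rho> i}"
  assumes \<theta>: "\<theta> 1 < \<theta> 2" "\<theta> 2 < \<theta> 3" "\<theta> 3 < \<theta> 4"
    and even: "even (card I)"
    and sq: "\<And>k. k \<in> {1..4} - I \<Longrightarrow> \<psi> k ^ 2 = 1"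
    and \<psi>: "\<exists>\<kappa>. \<forall>k\<in>{1..4} - I. \<psi> k = \<kappa> * (\<Prod>i\<in>I. of_real (sgn (\<theta> k - \<theta> i)))"
  shows "(\<Prod>k\<in>{1..4}. if \<rho> k then 1 else \<psi> k) = of_real (crossing_sign (\<rho> 1) (\<rho> 2) (\<rho> 3) (\<rho> 4))"
proof -
  obtain \<kappa> where \<kappa>: "\<And>k. k \<in> {1..4} - I \<Longrightarrow> \<psi> k = \<kappa> * (\<Prod>i\<in>I. of_real (sgn (\<theta> k - \<theta> i)))"
    using \<psi> by blast
  let ?s = "\<lambda>k i. if \<rho> i then complex_of_real (sgn (\<theta> k - \<theta> i)) else 1"
  have prod: "(\<Prod>i\<in>I. f i) = (if \<rho> 1 then f 1 else 1) * (if \<rho> 2 then f 2 else 1) *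
      (if \<rho> 3 then f 3 else 1) * (if \<rho> 4 then f 4 else 1)" for f :: "nat \<Rightarrow> complex"
    unfolding I_def prod.inter_filter[OF finite_atLeastAtMost] prod_1_4 ..
  have eq: "\<rho> k \<or> \<psi> k = \<kappa> * (?s k 1 * ?s k 2 * ?s k 3 * ?s k 4) \<and> \<psi> k ^ 2 = 1" if "k \<in> {1..4}" for k
  proof (cases "\<rho> k")
    case False
    then have k: "k \<in> {1..4} - I" using that by (simp add: I_def)
    show ?thesis using \<kappa>[OF k, unfolded prod] sq[OF k] by blast
  qed simp
  have sgn: "sgn (\<theta> 2 - \<theta> 1) = 1" "sgn (\<theta> 3 - \<theta> 1) = 1" "sgn (\<theta> 4 - \<theta> 1) = 1"
    "sgn (\<theta> 3 - \<theta> 2) = 1" "sgn (\<theta> 4 - \<theta> 2) = 1" "sgn (\<theta> 4 - \<theta> 3) = 1"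
    "sgn (\<theta> 1 - \<theta> 2) = - 1" "sgn (\<theta> 1 - \<theta> 3) = - 1" "sgn (\<theta> 1 - \<theta> 4) = - 1"
    "sgn (\<theta> 2 - \<theta> 3) = - 1" "sgn (\<theta> 2 - \<theta> 4) = - 1" "sgn (\<theta> 3 - \<theta> 4) = - 1"
    using \<theta> by (simp_all add: sgn_if)
  have e: "even (ones (\<rho> 1) (\<rho> 2) (\<rho> 3) (\<rho> 4))"
    using even by (simp only: I_def card_filter_1_4)
  \<comment> \<open>With all four labels red there is no green one from which
    \<open>\<kappa>\<close> could be determined.\<close>
  have "\<rho> 1 \<and> \<rho> 2 \<and> \<rho> 3 \<and> \<rho> 4 \<or> \<kappa> = 1 \<or> \<kappa> = -1"
    using eq[of 1] eq[of 2] eq[of 3] eq[of 4] e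
    by (cases "\<rho> 1"; cases "\<rho> 2"; cases "\<rho> 3"; cases "\<rho> 4")
      (simp_all add: sgn ones_def power2_eq_1_iff del: One_nat_def)
  moreover note eq[of 1] eq[of 2] eq[of 3] eq[of 4] e
  ultimately show ?thesis
    unfolding prod_1_4
    by (cases "\<rho> 1"; cases "\<rho> 2"; cases "\<rho> 3"; cases "\<rho> 4")
      (auto simp add: sgn ones_def crossing_sign_def simp del: One_nat_def)
qed

section \<open>Arms and bodies of drawn edges\<close>

text \<open>An internal edge is cut at its midpoint, so that each edge-end, also each end of a loop,
  gets its own curve starting at its vertex. A dangling edge is kept up to its free end.\<close>

definition arm :: "('e edge \<Rightarrow> real \<Rightarrow> complex) \<Rightarrow> 'e edge \<times> bool \<Rightarrow> real \<Rightarrow> complex" where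
  "arm \<gamma> x = (case fst x of Internal e \<Rightarrow> subpath 0 (1/2) (end_curve \<gamma> x) | Dangling i \<Rightarrow> \<gamma> (Dangling i))"

text \<open>The edge without its vertices. The free end of a dangling edge is included, since
  boundary signs are read there.\<close>

definition body :: "('e edge \<Rightarrow> real \<Rightarrow> complex) \<Rightarrow> 'e edge \<Rightarrow> complex set" where
  "body \<gamma> e = (case e of Internal _ \<Rightarrow> \<gamma> e ` {0<..<1} | Dangling _ \<Rightarrow> \<gamma> e ` {0<..1})"

lemma edge_ends_cases [consumes 1, case_names internal dangling]:
  assumes "x \<in> edge_ends G"
  obtains e s where "e \<in> edges G" "x = (Internal e, s)" | i where "i \<in> {1..4}" "x = (Dangling i, False)"
  using assms unfolding edge_ends_def by blast

lemma all_edges_cases [consumes 1, case_names internal dangling]: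
  assumes "x \<in> all_edges G"
  obtains e where "e \<in> edges G" "x = Internal e" | i where "i \<in> {1..4}" "x = Dangling i"
  using assms unfolding all_edges_def by blast

locale drawing =
  fixes G :: "('v, 'e) construction" and pos :: "'v \<Rightarrow> complex"
    and \<gamma> :: "'e edge \<Rightarrow> real \<Rightarrow> complex" and R :: real and \<theta> :: "nat \<Rightarrow> real"
  assumes G: "four_ary_construction G"
    and inj_pos: "inj_on pos (verts G)"
    and simple: "\<And>x. x \<in> all_edges G \<Longrightarrow> simple_path (\<gamma> x)"
    and start: "\<And>v i. \<lbrakk>v \<in> verts G; i \<in> {1..4}\<rbrakk> \<Longrightarrow> pathstart (end_curve \<gamma> (end_at G v i)) = pos v"
    and no_vertex: "\<And>x. x \<in> all_edges G \<Longrightarrow> \<gamma> x ` {0<..<1} \<inter> pos ` verts G = {}"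
    and disjoint: "\<And>x y. \<lbrakk>x \<in> all_edges G; y \<in> all_edges G; x \<noteq> y\<rbrakk> \<Longrightarrow>
      \<gamma> x ` {0<..<1} \<inter> \<gamma> y ` {0<..<1} = {}"
    and R: "0 < R"
    and internal_ball: "\<And>e. e \<in> edges G \<Longrightarrow> path_image (\<gamma> (Internal e)) \<subseteq> ball 0 R"
    and dangling_ball: "\<And>i. i \<in> {1..4} \<Longrightarrow> \<gamma> (Dangling i) ` {0..<1} \<subseteq> ball 0 R"
    and finish: "\<And>i. i \<in> {1..4} \<Longrightarrow> \<gamma> (Dangling i) 1 = of_real R * cis (\<theta> i)"
    and \<theta>: "\<theta> 1 < \<theta> 2" "\<theta> 2 < \<theta> 3" "\<theta> 3 < \<theta> 4" "\<theta> 4 < \<theta> 1 + 2 * pi"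
    and circles: "\<And>v. v \<in> verts G \<Longrightarrow> eventually (\<lambda>r. \<exists>p. ccw_on_circle (pos v) r p \<and>
        (\<forall>i\<in>{1..4}. first_hit (end_curve \<gamma> (end_at G v i)) (pos v) r (p i))) (at_right 0)"
begin

lemma path_edge: "x \<in> all_edges G \<Longrightarrow> path (\<gamma> x)"
  using simple by (simp add: simple_path_imp_path)

lemma arm_Internal:
  "t \<in> {0..1} \<Longrightarrow> arm \<gamma> (Internal e, s) t = \<gamma> (Internal e) (if s then 1 - t / 2 else t / 2)"
  by (simp add: arm_def subpath_def reversepath_def)

lemma arm_Dangling: "arm \<gamma> (Dangling i, s) = \<gamma> (Dangling i)"
  by (simp add: arm_def)

lemma path_arm: "x \<in> edge_ends G \<Longrightarrow> path (arm \<gamma> x)"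
  by (cases rule: edge_ends_cases)
    (auto simp: arm_def path_edge all_edges_def path_reversepath intro!: path_subpath)

lemma pathstart_arm:
  assumes "v \<in> verts G" "i \<in> {1..4}"
  shows "pathstart (arm \<gamma> (end_at G v i)) = pos v"
proof -
  have "pathstart (arm \<gamma> (end_at G v i)) = pathstart (end_curve \<gamma> (end_at G v i))"
    using end_at_in_edge_ends[OF G assms]
    by (cases rule: edge_ends_cases) (auto simp: arm_def pathstart_def subpath_def)
  then show ?thesis by (simp add: start[OF assms])
qed

lemma arm_in_body:
  assumes "x \<in> edge_ends G" "t \<in> {0<..1}"
  shows "arm \<gamma> x t \<in> body \<gamma> (fst x)"
  using assms by (cases rule: edge_ends_cases) (auto simp: arm_Internal arm_Dangling body_def intro!: imageI)

lemma norm_finish: "i \<in> {1..4} \<Longrightarrow> norm (\<gamma> (Dangling i) 1) = R"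
  using R by (simp add: finish norm_mult)

lemma angle_differences:
  assumes "i \<in> {1..4}" "j \<in> {1..4}" "i \<noteq> j"
  shows "0 < \<bar>\<theta> i - \<theta> j\<bar> \<and> \<bar>\<theta> i - \<theta> j\<bar> < 2 * pi"
  using assms \<theta> unfolding atLeastAtMost_1_4 by auto

lemma finish_inj:
  assumes "i \<in> {1..4}" "j \<in> {1..4}" "\<gamma> (Dangling i) 1 = \<gamma> (Dangling j) 1"
  shows "i = j"
proof (rule ccontr)
  assume "i \<noteq> j"
  have "cis (\<theta> i) / cis (\<theta> j) = 1" using assms R by (simp add: finish)
  then show False
    using cis_neq_1[of "\<theta> i - \<theta> j"] angle_differences[OF assms(1,2) \<open>i \<noteq> j\<close>] by (simp add: cis_divide)
qed

lemma body_cases: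
  assumes "e \<in> all_edges G" "z \<in> body \<gamma> e"
  obtains "z \<in> \<gamma> e ` {0<..<1}" "z \<in> ball 0 R"
    | i where "i \<in> {1..4}" "e = Dangling i" "z = \<gamma> (Dangling i) 1" "z \<in> sphere 0 R"
  using assms(1)
proof (cases rule: all_edges_cases)
  case (internal a)
  then have "z \<in> \<gamma> e ` {0<..<1}" using assms(2) by (simp add: body_def)
  moreover have "\<gamma> e ` {0<..<1} \<subseteq> path_image (\<gamma> e)" by (auto simp: path_image_def)
  ultimately show ?thesis using that(1) internal internal_ball by blast
next
  case (dangling i)
  then obtain t where t: "t \<in> {0<..1}" "z = \<gamma> e t" using assms(2) by (auto simp: body_def)
  show ?thesis
  proof (cases "t = 1")
    case True
    then show ?thesis using that(2) dangling t norm_finish by auto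
  next
    case False
    then have "z \<in> \<gamma> e ` {0<..<1}" "z \<in> \<gamma> e ` {0..<1}" using t by auto
    then show ?thesis using that(1) dangling dangling_ball by blast
  qed
qed

text \<open>Interior points of edges lie in the open disc, where \<open>disjoint\<close> applies;
  the free ends lie on the boundary circle and are distinct by \<open>finish_inj\<close>.\<close>

lemma body_disjoint:
  assumes "e \<in> all_edges G" "f \<in> all_edges G" "e \<noteq> f"
  shows "body \<gamma> e \<inter> body \<gamma> f = {}"
proof (rule ccontr)
  assume "body \<gamma> e \<inter> body \<gamma> f \<noteq> {}"
  then obtain z where z: "z \<in> body \<gamma> e" "z \<in> body \<gamma> f" by blast
  from assms(1) z(1) show False
  proof (cases rule: body_cases)
    case 1
    from assms(2) z(2) show False
      by (cases rule: body_cases) (use 1 disjoint[OF assms] in auto)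
  next
    case (2 i)
    from assms(2) z(2) show False
      by (cases rule: body_cases) (use 2 finish_inj assms(3) in auto)
  qed
qed

lemma pos_in_ball: "v \<in> verts G \<Longrightarrow> pos v \<in> ball 0 R"
proof -
  assume v: "v \<in> verts G"
  have 1: "(1::nat) \<in> {1..4}" by simp
  have "pathstart (arm \<gamma> (end_at G v 1)) \<in> ball 0 R"
    using end_at_in_edge_ends[OF G v 1]
  proof (cases rule: edge_ends_cases)
    case (internal e s)
    then have "pathstart (arm \<gamma> (end_at G v 1)) \<in> path_image (\<gamma> (Internal e))"
      by (auto simp: pathstart_def arm_Internal path_image_def)
    then show ?thesis using internal_ball[OF internal(1)] by blast
  next
    case (dangling i)
    have "\<gamma> (Dangling i) 0 \<in> \<gamma> (Dangling i) ` {0..<1}" by simp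
    then show ?thesis
      using dangling_ball[OF dangling(1)] unfolding dangling(2) pathstart_def arm_Dangling by blast
  qed
  then show "pos v \<in> ball 0 R" by (simp only: pathstart_arm[OF v 1])
qed

lemma body_no_vertex:
  assumes "e \<in> all_edges G" "v \<in> verts G"
  shows "pos v \<notin> body \<gamma> e"
proof
  assume "pos v \<in> body \<gamma> e"
  with assms(1) show False
  proof (cases rule: body_cases)
    case 1
    then show False using no_vertex[OF assms(1)] assms(2) by blast
  qed (use pos_in_ball[OF assms(2)] in auto)
qed

lemma body_subset_cball: "e \<in> all_edges G \<Longrightarrow> body \<gamma> e \<subseteq> cball 0 R"
  by (auto elim!: body_cases)

lemma connected_body:
  assumes "e \<in> all_edges G"
  shows "connected (body \<gamma> e)"
proof -
  have "continuous_on {0..1} (\<gamma> e)" using path_edge[OF assms] by (simp add: path_def)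
  then have "continuous_on {0<..<1} (\<gamma> e)" "continuous_on {0<..1} (\<gamma> e)"
    by (auto elim: continuous_on_subset)
  then show ?thesis
    unfolding body_def by (auto split: edge.split intro!: connected_continuous_image)
qed

lemma path_image_arm:
  assumes "v \<in> verts G" "i \<in> {1..4}"
  shows "path_image (arm \<gamma> (end_at G v i)) \<subseteq> insert (pos v) (body \<gamma> (fst (end_at G v i)))"
proof
  fix z assume "z \<in> path_image (arm \<gamma> (end_at G v i))"
  then obtain t where t: "t \<in> {0..1}" "z = arm \<gamma> (end_at G v i) t" by (auto simp: path_image_def)
  show "z \<in> insert (pos v) (body \<gamma> (fst (end_at G v i)))"
  proof (cases "t = 0")
    case True
    then show ?thesis using t pathstart_arm[OF assms] by (simp add: pathstart_def)
  next
    case False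
    then show ?thesis using t arm_in_body[OF end_at_in_edge_ends[OF G assms]] by auto
  qed
qed

text \<open>The far end of the arm lies outside the small circle, so on an internal edge the first
  hit comes no later than the midpoint. The arm runs at half speed, which doubles the hitting
  time.\<close>

lemma first_hit_arm:
  assumes "x \<in> edge_ends G" "first_hit (end_curve \<gamma> x) z r p" "r < dist z (arm \<gamma> x 1)"
  shows "first_hit (arm \<gamma> x) z r p"
  using assms(1)
proof (cases rule: edge_ends_cases)
  case (internal e s)
  have arm: "arm \<gamma> x t = end_curve \<gamma> x (t / 2)" for t
    by (simp add: arm_def internal subpath_def)
  obtain t where t: "t \<in> {0..1}" "end_curve \<gamma> x t = p" "dist z p = r"
      "\<And>s. s \<in> {0..<t} \<Longrightarrow> dist z (end_curve \<gamma> x s) < r"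
    using assms(2) unfolding first_hit_def by blast
  have "t \<le> 1 / 2"
    using t(4)[of "1 / 2"] assms(3) by (fastforce simp: arm)
  then show ?thesis unfolding first_hit_def arm
    using t by (intro bexI[of _ "2 * t"]) auto
next
  case (dangling i)
  then show ?thesis using assms(2) by (simp add: arm_def)
qed

end

section \<open>Square roots branched along the red edges\<close>

locale coloured_drawing = drawing G pos \<gamma> R \<theta>
  for G :: "('v, 'e) construction" and pos \<gamma> R \<theta> +
  fixes \<beta> :: "'e edge \<Rightarrow> bool"
  assumes even: "\<And>v. v \<in> verts G \<Longrightarrow> even (at_vertex G ones \<beta> v)"
begin

definition red_labels :: "'v \<Rightarrow> nat set" where
  "red_labels v = {i \<in> {1..4}. \<beta> (fst (end_at G v i))}"

definition red_dangling :: "nat set" where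
  "red_dangling = {i \<in> {1..4}. \<beta> (Dangling i)}"

definition edge_mid :: "'e \<Rightarrow> complex" where
  "edge_mid e = \<gamma> (Internal e) (1/2)"

definition tip :: "nat \<Rightarrow> complex" where
  "tip i = \<gamma> (Dangling i) 1"

text \<open>The square of the numerator contains \<open>pos v - z\<close> once for every red arm;
  the denominator removes these factors and leaves the far ends of the arms.\<close>

definition vertex_root :: "'v \<Rightarrow> complex \<Rightarrow> complex" where
  "vertex_root v z = (\<Prod>i\<in>red_labels v. path_root (arm \<gamma> (end_at G v i)) z) /
     (pos v - z) ^ (card (red_labels v) div 2)"

text \<open>The midpoint of a red internal edge is the far end of two arms, so one factor
  \<open>edge_mid e - z\<close> per edge removes it from the square. What stays are the tips of the
  red dangling edges.\<close>

definition red_root :: "complex \<Rightarrow> complex" where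
  "red_root z = (\<Prod>v\<in>verts G. vertex_root v z) / (\<Prod>e\<in>{e \<in> edges G. \<beta> (Internal e)}. edge_mid e - z)"

definition red_set :: "complex set" where
  "red_set = (\<Union>v\<in>verts G. \<Union>i\<in>red_labels v. path_image (arm \<gamma> (end_at G v i)))"

text \<open>A square root of the same polynomial as \<open>red_root\<close>, but without cuts inside
  the disc; the quotient of the two is the sign to be followed.\<close>

definition tip_root :: "complex \<Rightarrow> complex" where
  "tip_root z = (\<Prod>i\<in>red_dangling. disc_root 0 (tip i) z)"

text \<open>The side of the red curves on which a green edge lies.\<close>

definition side :: "'e edge \<Rightarrow> complex" where
  "side e = red_root (\<gamma> e (1/2)) / tip_root (\<gamma> e (1/2))"

lemma finite_verts: "finite (verts G)" and finite_edges: "finite (edges G)"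
  using G by (simp_all add: four_ary_construction_def)

lemma red_labels_subset: "red_labels v \<subseteq> {1..4}" and finite_red_labels: "finite (red_labels v)"
  by (auto simp: red_labels_def)

lemma even_red_labels: "v \<in> verts G \<Longrightarrow> even (card (red_labels v))"
  using even by (simp only: red_labels_def card_filter_1_4)

lemma even_red_dangling: "even (card red_dangling)"
  using even_boundary[OF G even] by (simp only: red_dangling_def card_filter_1_4)

lemma fst_end_at: "\<lbrakk>v \<in> verts G; i \<in> {1..4}\<rbrakk> \<Longrightarrow> fst (end_at G v i) \<in> all_edges G"
  by (intro fst_edge_ends end_at_in_edge_ends[OF G])

lemma end_at_surj:
  assumes "x \<in> edge_ends G"
  obtains v i where "v \<in> verts G" "i \<in> {1..4}" "x = end_at G v i"
proof -
  have "bij_betw (\<lambda>(v, i). end_at G v i) (verts G \<times> {1..4}) (edge_ends G)"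
    using G by (simp add: four_ary_construction_def)
  then have "x \<in> (\<lambda>(v, i). end_at G v i) ` (verts G \<times> {1..4})"
    using assms by (simp only: bij_betw_imp_surj_on)
  then show ?thesis using that by force
qed

lemma red_set_subset:
  "red_set \<subseteq> pos ` verts G \<union> (\<Union>e\<in>{e \<in> all_edges G. \<beta> e}. body \<gamma> e)"
proof
  fix z assume "z \<in> red_set"
  then obtain v i where v: "v \<in> verts G" "i \<in> {1..4}" "\<beta> (fst (end_at G v i))"
      "z \<in> path_image (arm \<gamma> (end_at G v i))"
    unfolding red_set_def red_labels_def by blast
  then have "z = pos v \<or> z \<in> body \<gamma> (fst (end_at G v i))" using path_image_arm[of v i] by blast
  then show "z \<in> pos ` verts G \<union> (\<Union>e\<in>{e \<in> all_edges G. \<beta> e}. body \<gamma> e)"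
    using v fst_end_at[of v i] by blast
qed

lemma red_set_cball: "red_set \<subseteq> cball 0 R"
proof -
  have "pos ` verts G \<subseteq> cball 0 R" using pos_in_ball ball_subset_cball by blast
  then show ?thesis using red_set_subset body_subset_cball by blast
qed

lemma red_set_sphere: "red_set \<inter> sphere 0 R \<subseteq> tip ` red_dangling"
proof
  fix z assume z: "z \<in> red_set \<inter> sphere 0 R"
  then have "z \<notin> ball 0 R" by auto
  then have "z \<notin> pos ` verts G" using pos_in_ball by blast
  then obtain e where e: "e \<in> all_edges G" "\<beta> e" "z \<in> body \<gamma> e" using z red_set_subset by blast
  from e(1,3) show "z \<in> tip ` red_dangling"
    by (cases rule: body_cases) (use z e(2) in \<open>auto simp: tip_def red_dangling_def\<close>)
qed

lemma green_body_disjoint: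
  assumes "e \<in> all_edges G" "\<not> \<beta> e" "z \<in> body \<gamma> e"
  shows "z \<notin> red_set" "z \<in> cball 0 R - tip ` red_dangling"
proof -
  have "z \<notin> body \<gamma> f" if "f \<in> all_edges G" "\<beta> f" for f
    using body_disjoint[OF assms(1) that(1)] assms that by blast
  moreover have "z \<notin> pos ` verts G" using body_no_vertex[OF assms(1)] assms(3) by blast
  ultimately show "z \<notin> red_set" using red_set_subset by blast
  have "z \<noteq> tip i" if "i \<in> red_dangling" for i
  proof
    assume "z = tip i"
    then have "z \<in> body \<gamma> (Dangling i)" by (simp add: tip_def body_def)
    moreover have "Dangling i \<in> all_edges G" "\<beta> (Dangling i)"
      using that by (auto simp: red_dangling_def all_edges_def)
    ultimately show False using body_disjoint[of e "Dangling i"] assms by blast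
  qed
  then show "z \<in> cball 0 R - tip ` red_dangling" using body_subset_cball[OF assms(1)] assms(3) by blast
qed

lemma arm_1:
  "x \<in> edge_ends G \<Longrightarrow> arm \<gamma> x 1 = (case fst x of Internal e \<Rightarrow> edge_mid e | Dangling i \<Rightarrow> tip i)"
  by (cases rule: edge_ends_cases) (auto simp: arm_Internal arm_Dangling edge_mid_def tip_def)

lemma isCont_vertex_root:
  assumes "v \<in> verts G" "\<And>i. i \<in> red_labels v \<Longrightarrow> z \<notin> path_image (arm \<gamma> (end_at G v i))"
    and "card (red_labels v) div 2 \<noteq> 0 \<Longrightarrow> z \<noteq> pos v"
  shows "isCont (vertex_root v) z"
  unfolding vertex_root_def
proof (intro continuous_intros continuous_path_root)
  show "path (arm \<gamma> (end_at G v i))" if "i \<in> red_labels v" for i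
    using that red_labels_subset by (intro path_arm end_at_in_edge_ends[OF G assms(1)]) blast
qed (use assms in auto)

lemma pos_in_red_set:
  assumes "v \<in> verts G" "card (red_labels v) div 2 \<noteq> 0"
  shows "pos v \<in> red_set"
proof -
  have "red_labels v \<noteq> {}" using assms(2) by auto
  then obtain i where i: "i \<in> red_labels v" by blast
  then have "pathstart (arm \<gamma> (end_at G v i)) = pos v"
    using assms(1) red_labels_subset by (intro pathstart_arm) blast+
  then have "pos v \<in> path_image (arm \<gamma> (end_at G v i))" by (metis pathstart_in_path_image)
  then show ?thesis using i assms(1) unfolding red_set_def by blast
qed

lemma edge_mid_in_red_set:
  assumes "e \<in> edges G" "\<beta> (Internal e)"
  shows "edge_mid e \<in> red_set"
proof -
  have x: "(Internal e, False) \<in> edge_ends G" using assms(1) by (simp add: edge_ends_def)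
  obtain v i where v: "v \<in> verts G" "i \<in> {1..4}" "(Internal e, False) = end_at G v i"
    using end_at_surj[OF x] by blast
  have "i \<in> red_labels v" using v assms(2) by (simp add: red_labels_def flip: v(3))
  moreover have "arm \<gamma> (end_at G v i) 1 = edge_mid e" unfolding v(3)[symmetric] arm_1[OF x] by simp
  then have "edge_mid e \<in> path_image (arm \<gamma> (end_at G v i))"
    by (metis pathfinish_in_path_image pathfinish_def)
  ultimately show ?thesis using v(1) unfolding red_set_def by blast
qed

lemma vertex_root_square:
  assumes "v \<in> verts G" "z \<notin> red_set"
  shows "vertex_root v z ^ 2 = (\<Prod>i\<in>red_labels v. arm \<gamma> (end_at G v i) 1 - z)"
proof -
  obtain m where c: "card (red_labels v) = 2 * m" using even_red_labels[OF assms(1)] by (elim evenE)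
  have ne: "(pos v - z) ^ m \<noteq> 0"
    using pos_in_red_set[OF assms(1)] assms(2) by (auto simp: c)
  have "path_root (arm \<gamma> (end_at G v i)) z ^ 2 = (pos v - z) * (arm \<gamma> (end_at G v i) 1 - z)"
    if "i \<in> red_labels v" for i
  proof -
    have i: "i \<in> {1..4}" using that red_labels_subset by blast
    have "z \<notin> path_image (arm \<gamma> (end_at G v i))" using assms that by (auto simp: red_set_def)
    then show ?thesis
      using path_root_square[OF path_arm[OF end_at_in_edge_ends[OF G assms(1) i]]] pathstart_arm[OF assms(1) i]
      by (simp add: pathfinish_def)
  qed
  then have "vertex_root v z ^ 2 = (\<Prod>i\<in>red_labels v. (pos v - z) * (arm \<gamma> (end_at G v i) 1 - z)) /
      (pos v - z) ^ card (red_labels v)"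
    by (simp add: c vertex_root_def power_divide prod_power_distrib mult.commute flip: power_mult)
  also have "\<dots> = (\<Prod>i\<in>red_labels v. arm \<gamma> (end_at G v i) 1 - z)"
    using ne by (simp add: c prod.distrib power_mult)
  finally show ?thesis .
qed

lemma red_root:
  assumes "z \<notin> red_set"
  shows "isCont red_root z" "red_root z ^ 2 = (\<Prod>i\<in>red_dangling. tip i - z)"
proof -
  let ?E = "{e \<in> edges G. \<beta> (Internal e)}"
  have mid: "(\<Prod>e\<in>?E. edge_mid e - z) \<noteq> 0"
    using assms edge_mid_in_red_set finite_edges by auto
  have "isCont (vertex_root v) z" if "v \<in> verts G" for v
    using assms that pos_in_red_set[OF that]
    by (intro isCont_vertex_root[OF that]) (auto simp: red_set_def)
  then show "isCont red_root z" unfolding red_root_def using mid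
    by (intro continuous_intros) auto
  define q where "q x = (if \<beta> (fst x) then arm \<gamma> x 1 - z else 1)" for x
  have "(\<Prod>v\<in>verts G. vertex_root v z) ^ 2 = (\<Prod>v\<in>verts G. \<Prod>i\<in>{1..4}. q (end_at G v i))"
    unfolding prod_power_distrib q_def
    by (intro prod.cong refl)
      (simp only: vertex_root_square[OF _ assms] red_labels_def prod.inter_filter[OF finite_atLeastAtMost])
  also have "\<dots> = (\<Prod>e\<in>edges G. q (Internal e, False) * q (Internal e, True)) *
      (\<Prod>i\<in>{1..4}. q (Dangling i, False))"
    by (simp only: prod_over_vertices[OF G] prod_edge_ends[OF G])
  also have "(\<Prod>e\<in>edges G. q (Internal e, False) * q (Internal e, True)) =
      (\<Prod>e\<in>edges G. if \<beta> (Internal e) then (edge_mid e - z) ^ 2 else 1)"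
    by (intro prod.cong refl) (simp add: q_def arm_1 edge_ends_def power2_eq_square)
  also have "\<dots> = (\<Prod>e\<in>?E. edge_mid e - z) ^ 2"
    unfolding prod_power_distrib prod.inter_filter[OF finite_edges] by (intro prod.cong refl) simp
  also have "(\<Prod>i\<in>{1..4}. q (Dangling i, False)) = (\<Prod>i\<in>{1..4}. if \<beta> (Dangling i) then tip i - z else 1)"
    by (intro prod.cong refl) (simp add: q_def arm_1 edge_ends_def)
  also have "\<dots> = (\<Prod>i\<in>red_dangling. tip i - z)"
    unfolding red_dangling_def prod.inter_filter[OF finite_atLeastAtMost] ..
  finally show "red_root z ^ 2 = (\<Prod>i\<in>red_dangling. tip i - z)"
    unfolding red_root_def power_divide using mid by simp
qed

lemma tip_root:
  assumes "z \<in> cball 0 R - tip ` red_dangling"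
  shows "isCont tip_root z" "tip_root z ^ 2 = (\<Prod>i\<in>red_dangling. tip i - z)" "tip_root z \<noteq> 0"
proof -
  have tip: "norm (tip i) = R" if "i \<in> red_dangling" for i
    using that norm_finish by (simp add: tip_def red_dangling_def)
  show "isCont tip_root z" unfolding tip_root_def
    using assms R tip by (intro continuous_intros continuous_disc_root) auto
  show sq: "tip_root z ^ 2 = (\<Prod>i\<in>red_dangling. tip i - z)"
    unfolding tip_root_def prod_power_distrib
    by (intro prod.cong refl disc_root_square) (use tip R in force)
  have "(\<Prod>i\<in>red_dangling. tip i - z) \<noteq> 0" using assms by (auto simp: red_dangling_def)
  then show "tip_root z \<noteq> 0" using sq by auto
qed

text \<open>The two roots have the same square, and the body of a green edge is a connected set on
  which both are continuous, so their quotient is constant there.\<close>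

lemma side:
  assumes e: "e \<in> all_edges G" "\<not> \<beta> e"
  shows "\<And>z. z \<in> body \<gamma> e \<Longrightarrow> red_root z / tip_root z = side e" "side e ^ 2 = 1"
proof -
  note off = green_body_disjoint[OF e]
  have sq: "(red_root z / tip_root z) ^ 2 = 1" if "z \<in> body \<gamma> e" for z
    using red_root(2)[OF off(1)[OF that]] tip_root(2,3)[OF off(2)[OF that]]
    by (simp add: power_divide) (metis power_not_zero)
  have m: "\<gamma> e (1/2) \<in> body \<gamma> e" by (auto simp: body_def split: edge.split)
  show "side e ^ 2 = 1" unfolding side_def by (rule sq[OF m])
  fix z assume z: "z \<in> body \<gamma> e"
  show "red_root z / tip_root z = side e"
    unfolding side_def
  proof (rule square_one_constant[OF connected_body[OF e(1)] _ sq z m])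
    show "continuous_on (body \<gamma> e) (\<lambda>z. red_root z / tip_root z)"
      using red_root(1)[OF off(1)] tip_root(1,3)[OF off(2)]
      by (intro continuous_at_imp_continuous_on ballI continuous_intros) auto
  qed
qed

text \<open>The red curves lie in the large disc and can meet its circle only in red tips, so
  \<open>boundary_sign\<close> gives the sides of the green dangling edges, and
  \<open>alternating_sign_product\<close> multiplies them.\<close>

lemma boundary_product:
  "(\<Prod>i\<in>{1..4}. if \<beta> (Dangling i) then 1 else side (Dangling i)) =
    complex_of_real (at_boundary crossing_sign \<beta>)"
proof -
  have edge: "Dangling i \<in> all_edges G" if "i \<in> {1..4}" for i using that by (simp add: all_edges_def)
  have tip: "tip i = 0 + of_real R * cis (\<theta> i)" if "i \<in> {1..4}" for i
    using finish[OF that] by (simp add: tip_def)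
  have "finite red_dangling" by (simp add: red_dangling_def)
  then obtain \<kappa> where \<kappa>: "\<And>x. (\<And>i. i \<in> red_dangling \<Longrightarrow> 0 < \<bar>x - \<theta> i\<bar> \<and> \<bar>x - \<theta> i\<bar> < 2 * pi) \<Longrightarrow>
      red_root (0 + of_real R * cis x) =
      \<kappa> * (\<Prod>i\<in>red_dangling. of_real (sgn (x - \<theta> i))) * tip_root (0 + of_real R * cis x)"
    using boundary_sign[OF _ even_red_dangling R tip red_set_cball red_set_sphere red_root]
    unfolding tip_root_def red_dangling_def by blast
  have "side (Dangling k) = \<kappa> * (\<Prod>i\<in>red_dangling. of_real (sgn (\<theta> k - \<theta> i)))"
    if k: "k \<in> {1..4} - red_dangling" for k
  proof -
    have k': "k \<in> {1..4}" "\<not> \<beta> (Dangling k)" using k by (auto simp: red_dangling_def)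
    have body: "tip k \<in> body \<gamma> (Dangling k)" by (simp add: tip_def body_def)
    have "red_root (tip k) = \<kappa> * (\<Prod>i\<in>red_dangling. of_real (sgn (\<theta> k - \<theta> i))) * tip_root (tip k)"
      unfolding tip[OF k'(1)]
      using k by (intro \<kappa> angle_differences) (auto simp: red_dangling_def)
    then show ?thesis
      using side(1)[OF edge[OF k'(1)] k'(2) body]
        tip_root(3)[OF green_body_disjoint(2)[OF edge[OF k'(1)] k'(2) body]] by simp
  qed
  then have "\<exists>\<kappa>. \<forall>k\<in>{1..4} - red_dangling. side (Dangling k) =
      \<kappa> * (\<Prod>i\<in>red_dangling. of_real (sgn (\<theta> k - \<theta> i)))" by blast
  moreover have "side (Dangling k) ^ 2 = 1" if "k \<in> {1..4} - red_dangling" for k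
    using that edge by (intro side(2)) (auto simp: red_dangling_def)
  ultimately show ?thesis
    using alternating_sign_product[where \<rho> = "\<lambda>i. \<beta> (Dangling i)" and \<psi> = "\<lambda>i. side (Dangling i)",
        OF \<theta>(1-3), folded red_dangling_def, OF even_red_dangling] by blast
qed

text \<open>The analogous computation on a small circle around the vertex, by
  \<open>vertex_sign\<close> for the four arms. The factors of \<open>red_root / tip_root\<close>
  that do not belong to \<open>v\<close> form \<open>L\<close>, which is continuous at
  \<open>pos v\<close>.\<close>

lemma vertex_product:
  assumes v: "v \<in> verts G"
  shows "(\<Prod>i\<in>{1..4}. if \<beta> (fst (end_at G v i)) then 1 else side (fst (end_at G v i))) =
    complex_of_real (at_vertex G crossing_sign \<beta> v)"
proof -
  let ?g = "\<lambda>i. arm \<gamma> (end_at G v i)"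
  let ?E = "{e \<in> edges G. \<beta> (Internal e)}"
  have x: "end_at G v i \<in> edge_ends G" if "i \<in> {1..4}" for i by (rule end_at_in_edge_ends[OF G v that])
  have g_body: "?g i t \<in> body \<gamma> (fst (end_at G v i))" if "i \<in> {1..4}" "t \<in> {0<..1}" for i t
    by (rule arm_in_body[OF x[OF that(1)] that(2)])
  have g_ne: "?g i t \<noteq> pos v" if "i \<in> {1..4}" "t \<in> {0<..1}" for i t
    using g_body[OF that] body_no_vertex[OF fst_end_at[OF v that(1)] v] by auto
  \<comment> \<open>A circle of radius less than \<open>d\<close> separates the vertex from the far
    ends of all four arms, as \<open>first_hit_arm\<close> requires.\<close>
  define d where "d = Min ((\<lambda>i. dist (pos v) (?g i 1)) ` {1..4})"
  have d: "0 < d" "\<And>i. i \<in> {1..4} \<Longrightarrow> d \<le> dist (pos v) (?g i 1)"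
  proof -
    have "0 < dist (pos v) (?g i 1)" if "i \<in> {1..4}" for i
      using g_ne[OF that, of 1] by (simp add: eq_commute)
    then show "0 < d" unfolding d_def by (subst Min_gr_iff) auto
  qed (simp add: d_def)
  have "eventually (\<lambda>r. r \<in> {0<..<d}) (at_right 0)"
    by (rule eventually_at_right_real[OF d(1)])
  from eventually_happens'[OF _ eventually_conj[OF this circles[OF v]]]
  obtain r p where r: "0 < r" "r < d" and ccw: "ccw_on_circle (pos v) r p"
    and hit: "\<And>i. i \<in> {1..4} \<Longrightarrow> first_hit (end_curve \<gamma> (end_at G v i)) (pos v) r (p i)"
    by auto
  from ccw obtain \<phi> where p: "\<And>i. i \<in> {1..4} \<Longrightarrow> p i = pos v + of_real r * cis (\<phi> i)"
    and \<phi>: "\<phi> 1 < \<phi> 2" "\<phi> 2 < \<phi> 3" "\<phi> 3 < \<phi> 4" "\<phi> 4 < \<phi> 1 + 2 * pi"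
    unfolding ccw_on_circle_def by blast
  define L where "L z = (\<Prod>w\<in>verts G - {v}. vertex_root w z) / (\<Prod>e\<in>?E. edge_mid e - z) / tip_root z" for z
  have "isCont L (pos v)"
  proof -
    have "isCont (vertex_root w) (pos v)" if w: "w \<in> verts G - {v}" for w
    proof (rule isCont_vertex_root)
      have "pos v \<noteq> pos w" using inj_pos v w by (auto simp: inj_on_def)
      then show "pos v \<noteq> pos w" .
      show "pos v \<notin> path_image (arm \<gamma> (end_at G w i))" if "i \<in> red_labels w" for i
      proof -
        have "i \<in> {1..4}" using that red_labels_subset by blast
        then show ?thesis
          using path_image_arm[of w i] body_no_vertex[OF fst_end_at v] \<open>pos v \<noteq> pos w\<close> w by blast
      qed
    qed (use w in simp)
    moreover have "(\<Prod>e\<in>?E. edge_mid e - pos v) \<noteq> 0"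
    proof -
      have "edge_mid e \<noteq> pos v" if "e \<in> edges G" for e
      proof -
        have "edge_mid e \<in> body \<gamma> (Internal e)" unfolding edge_mid_def body_def by simp
        moreover have "Internal e \<in> all_edges G" using that by (simp add: all_edges_def)
        ultimately show ?thesis using body_no_vertex v by metis
      qed
      then show ?thesis using finite_edges by simp
    qed
    moreover have "pos v \<noteq> tip i" if "i \<in> red_dangling" for i
    proof -
      have "norm (tip i) = R" using norm_finish[of i] that by (simp add: tip_def red_dangling_def)
      then show ?thesis using pos_in_ball[OF v] by auto
    qed
    then have off: "pos v \<in> cball 0 R - tip ` red_dangling"
      using pos_in_ball[OF v] by auto
    moreover note tip_root(1,3)[OF off]
    ultimately show ?thesis
      unfolding L_def by (intro isCont_divide continuous_prod continuous_diff continuous_const continuous_ident)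
  qed
  have "\<exists>\<kappa>. \<forall>k\<in>{1..4} - red_labels v. side (fst (end_at G v k)) =
      \<kappa> * (\<Prod>i\<in>red_labels v. of_real (sgn (\<phi> k - \<phi> i)))"
  proof (rule vertex_sign[where J = "{1..4}" and I = "red_labels v" and g = ?g, OF _ red_labels_subset
        even_red_labels[OF v] _ _ g_ne r(1) p])
    show "path (?g i)" if "i \<in> {1..4}" for i by (rule path_arm[OF x[OF that]])
    show "pathstart (?g i) = pos v" if "i \<in> {1..4}" for i by (rule pathstart_arm[OF v that])
    show "0 < \<bar>\<phi> k - \<phi> i\<bar> \<and> \<bar>\<phi> k - \<phi> i\<bar> < 2 * pi" if "i \<in> red_labels v" "k \<in> {1..4} - red_labels v" for i k
      using that \<phi> red_labels_subset[of v] unfolding atLeastAtMost_1_4 by auto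
    show "first_hit (?g i) (pos v) r (p i)" if "i \<in> {1..4}" for i
      using d(2)[OF that] r(2) by (intro first_hit_arm x hit that) simp
    show "?g i ` {0<..1} \<inter> ?g k ` {0<..1} = {}" if "i \<in> red_labels v" "k \<in> {1..4} - red_labels v" for i k
    proof -
      have ik: "i \<in> {1..4}" "k \<in> {1..4}" "\<beta> (fst (end_at G v i))" "\<not> \<beta> (fst (end_at G v k))"
        using that by (auto simp: red_labels_def)
      then have "body \<gamma> (fst (end_at G v i)) \<inter> body \<gamma> (fst (end_at G v k)) = {}"
        by (intro body_disjoint fst_end_at[OF v]) auto
      moreover have "?g j ` {0<..1} \<subseteq> body \<gamma> (fst (end_at G v j))" if "j \<in> {1..4}" for j
        using g_body[OF that] by (rule image_subsetI)
      ultimately show ?thesis using ik(1,2) by blast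
    qed
    show "isCont L (pos v)" by fact
    show "(\<Prod>i\<in>red_labels v. path_root (?g i) (?g k t)) / (pos v - ?g k t) ^ (card (red_labels v) div 2) *
        L (?g k t) = side (fst (end_at G v k))" if "k \<in> {1..4} - red_labels v" "t \<in> {0<..1}" for k t
    proof -
      have k: "k \<in> {1..4}" "\<not> \<beta> (fst (end_at G v k))" using that by (auto simp: red_labels_def)
      have "red_root z / tip_root z = vertex_root v z * L z" for z
        unfolding red_root_def L_def by (simp add: prod.remove[OF finite_verts v])
      then show ?thesis
        using side(1)[OF fst_end_at[OF v k(1)] k(2) g_body[OF k(1) that(2)]]
        unfolding vertex_root_def by (simp only:)
    qed
  qed simp
  moreover have "side (fst (end_at G v k)) ^ 2 = 1" if "k \<in> {1..4} - red_labels v" for k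
    using that fst_end_at[OF v] by (intro side(2)) (auto simp: red_labels_def)
  ultimately show ?thesis
    using alternating_sign_product[where \<rho> = "\<lambda>i. \<beta> (fst (end_at G v i))" and
        \<psi> = "\<lambda>i. side (fst (end_at G v i))",
        OF \<phi>(1-3), folded red_labels_def, OF even_red_labels[OF v]] by blast
qed

text \<open>Multiply \<open>vertex_product\<close> over all vertices: a green internal edge occurs
  with both its ends and contributes \<open>side e ^ 2 = 1\<close>, which leaves the product in
  \<open>boundary_product\<close>.\<close>

lemma crossing_product:
  "(\<Prod>v\<in>verts G. at_vertex G crossing_sign \<beta> v) = at_boundary crossing_sign \<beta>"
proof -
  define q where "q x = (if \<beta> (fst x) then 1 else side (fst x))" for x :: "'e edge \<times> bool"
  have "complex_of_real (\<Prod>v\<in>verts G. at_vertex G crossing_sign \<beta> v) =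
      (\<Prod>v\<in>verts G. \<Prod>i\<in>{1..4}. q (end_at G v i))"
    unfolding of_real_prod q_def by (intro prod.cong refl vertex_product[symmetric])
  also have "\<dots> = (\<Prod>e\<in>edges G. q (Internal e, False) * q (Internal e, True)) *
      (\<Prod>i\<in>{1..4}. q (Dangling i, False))"
    by (simp only: prod_over_vertices[OF G] prod_edge_ends[OF G])
  also have "(\<Prod>e\<in>edges G. q (Internal e, False) * q (Internal e, True)) = 1"
    using side(2) by (intro prod.neutral) (auto simp: q_def all_edges_def power2_eq_square)
  also have "(\<Prod>i\<in>{1..4}. q (Dangling i, False)) = complex_of_real (at_boundary crossing_sign \<beta>)"
    by (simp only: q_def fst_conv boundary_product)
  finally show ?thesis by (simp only: mult_1_left of_real_eq_iff)
qed

end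

text \<open>Planarity enters the algebra below only through this identity.\<close>

lemma crossing_parity:
  assumes P: "planar_four_ary_construction G"
    and even: "\<And>v. v \<in> verts G \<Longrightarrow> even (at_vertex G ones \<beta> v)"
  shows "(\<Prod>v\<in>verts G. at_vertex G crossing_sign \<beta> v) = at_boundary crossing_sign \<beta>"
proof -
  obtain pos \<gamma> where G: "four_ary_construction G" and D: "plane_drawing G pos \<gamma>"
    using P by (auto simp: planar_four_ary_construction_def)
  note D = D[unfolded plane_drawing_def]
  have inj: "inj_on pos (verts G)" using D by (elim conjE)
  have simple: "\<forall>x\<in>all_edges G. simple_path (\<gamma> x)" using D by (elim conjE)
  have start: "\<forall>v\<in>verts G. \<forall>i\<in>{1..4}. pathstart (end_curve \<gamma> (end_at G v i)) = pos v"
    using D by (elim conjE)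
  have no_vertex: "\<forall>x\<in>all_edges G. \<gamma> x ` {0<..<1} \<inter> pos ` verts G = {}" using D by (elim conjE)
  have disjoint: "\<forall>x\<in>all_edges G. \<forall>y\<in>all_edges G. x \<noteq> y \<longrightarrow> \<gamma> x ` {0<..<1} \<inter> \<gamma> y ` {0<..<1} = {}"
    using D by (elim conjE)
  have circles: "\<forall>v\<in>verts G. eventually (\<lambda>r. \<exists>p. ccw_on_circle (pos v) r p \<and>
      (\<forall>i\<in>{1..4}. first_hit (end_curve \<gamma> (end_at G v i)) (pos v) r (p i))) (at_right 0)"
    using D by (elim conjE)
  have "\<exists>R>0. (\<forall>e\<in>edges G. path_image (\<gamma> (Internal e)) \<subseteq> ball 0 R) \<and>
      (\<forall>i\<in>{1..4}. \<gamma> (Dangling i) ` {0..<1} \<subseteq> ball 0 R) \<and>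
      ccw_on_circle 0 R (\<lambda>i. pathfinish (\<gamma> (Dangling i)))"
    using D by (elim conjE)
  then obtain R where R: "0 < R" "\<forall>e\<in>edges G. path_image (\<gamma> (Internal e)) \<subseteq> ball 0 R"
      "\<forall>i\<in>{1..4}. \<gamma> (Dangling i) ` {0..<1} \<subseteq> ball 0 R"
      "ccw_on_circle 0 R (\<lambda>i. pathfinish (\<gamma> (Dangling i)))"
    by (elim exE conjE)
  obtain \<theta> where \<theta>: "\<forall>i\<in>{1..4}. pathfinish (\<gamma> (Dangling i)) = 0 + of_real R * cis (\<theta> i)"
      "\<theta> 1 < \<theta> 2" "\<theta> 2 < \<theta> 3" "\<theta> 3 < \<theta> 4" "\<theta> 4 < \<theta> 1 + 2 * pi"
    using R(4) unfolding ccw_on_circle_def by blast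
  have finish: "\<gamma> (Dangling i) 1 = of_real R * cis (\<theta> i)" if "i \<in> {1..4}" for i
    using bspec[OF \<theta>(1) that] by (simp add: pathfinish_def)
  interpret coloured_drawing G pos \<gamma> R \<theta> \<beta>
    by unfold_locales (fact G inj R(1) \<theta>(2-) finish even | rule bspec[OF simple] bspec[OF bspec[OF start]]
      bspec[OF no_vertex] bspec[OF R(2)] bspec[OF R(3)] bspec[OF circles]
      bspec[OF bspec[OF disjoint], rule_format], assumption+)+
  show ?thesis by (rule crossing_product)
qed

section \<open>Signs and sizes of the Fourier coefficients\<close>

text \<open>The sign for exactly two red ends that are neighbours, that is, for the words carrying
  the parameters \<open>a\<close> and \<open>b\<close>.\<close>

definition turn_sign :: "bool \<Rightarrow> bool \<Rightarrow> bool \<Rightarrow> bool \<Rightarrow> real" where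
  "turn_sign y1 y2 y3 y4 = (if (y1 = y2 \<and> y3 = y4 \<or> y1 = y4 \<and> y2 = y3) \<and> y1 \<noteq> y3 then -1 else 1)"

lemma turn_sign_eq:
  "even (ones y1 y2 y3 y4) \<Longrightarrow>
     turn_sign y1 y2 y3 y4 = crossing_sign y1 y2 y3 y4 * (-1) ^ (ones y1 y2 y3 y4 div 2)"
  by (cases y1; cases y2; cases y3; cases y4)
    (simp_all add: ones_def turn_sign_def crossing_sign_def)

lemma eight_vertex_turn_sign:
  "eight_vertex (- a, - b, c, d) y1 y2 y3 y4 = turn_sign y1 y2 y3 y4 * eight_vertex (a, b, c, d) y1 y2 y3 y4"
  by (cases y1; cases y2; cases y3; cases y4) (simp_all add: turn_sign_def eight_vertex_def)

lemma eight_vertex_odd: "odd (ones y1 y2 y3 y4) \<Longrightarrow> eight_vertex p y1 y2 y3 y4 = 0"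
  by (cases p; cases y1; cases y2; cases y3; cases y4) (simp_all add: ones_def eight_vertex_def)

text \<open>By handshaking, half the red ends at the vertices add up to the number of red internal
  edges plus half the red dangling edges. So the powers of \<open>-1\<close> from
  \<open>turn_sign_eq\<close> cancel the edge signs up to a boundary term, and
  \<open>crossing_parity\<close> settles the crossings.\<close>

lemma turn_sign_parity:
  assumes P: "planar_four_ary_construction G"
    and even: "\<And>v. v \<in> verts G \<Longrightarrow> even (at_vertex G ones \<beta> v)"
  shows "(\<Prod>v\<in>verts G. at_vertex G turn_sign \<beta> v) * (\<Prod>e\<in>edges G. edge_sign (\<beta> (Internal e))) =
    at_boundary turn_sign \<beta>"
proof -
  have G: "four_ary_construction G" using P by (simp add: planar_four_ary_construction_def)
  let ?m = "\<lambda>v. at_vertex G ones \<beta> v div 2"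
  let ?k = "\<Sum>e\<in>edges G. of_bool (\<beta> (Internal e)) :: nat"
  have bd: "even (at_boundary ones \<beta>)" using even_boundary[OF G even] .
  have "2 * (\<Sum>v\<in>verts G. ?m v) = (\<Sum>v\<in>verts G. at_vertex G ones \<beta> v)"
    unfolding sum_distrib_left by (intro sum.cong refl) (use even in auto)
  then have "2 * (\<Sum>v\<in>verts G. ?m v) = 2 * ?k + at_boundary ones \<beta>"
    unfolding handshake_ones[OF G] .
  then have m: "(\<Sum>v\<in>verts G. ?m v) = ?k + at_boundary ones \<beta> div 2"
    using bd by presburger
  have "(\<Prod>v\<in>verts G. at_vertex G turn_sign \<beta> v) =
      (\<Prod>v\<in>verts G. at_vertex G crossing_sign \<beta> v * (-1) ^ ?m v)"
    by (intro prod.cong refl turn_sign_eq even)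
  also have "\<dots> = at_boundary crossing_sign \<beta> * (-1) ^ (\<Sum>v\<in>verts G. ?m v)"
    by (simp only: prod.distrib crossing_parity[OF P even] power_sum)
  also have "\<dots> = at_boundary turn_sign \<beta> * (-1) ^ ?k"
    using turn_sign_eq[OF bd] by (simp only: m power_add mult_ac)
  finally have 1: "(\<Prod>v\<in>verts G. at_vertex G turn_sign \<beta> v) = at_boundary turn_sign \<beta> * (-1) ^ ?k" .
  have 2: "(\<Prod>e\<in>edges G. edge_sign (\<beta> (Internal e))) = (-1) ^ ?k"
    unfolding power_sum by (intro prod.cong refl) (simp add: edge_sign_def)
  have 3: "(-1) ^ ?k * (-1) ^ ?k = (1::real)"
    by (simp flip: power_add power_mult_distrib)
  show ?thesis unfolding 1 2 by (simp only: mult.assoc 3 mult_1_right)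
qed

section \<open>Counting colourings by their boundary\<close>

definition colourings :: "('v, 'e) construction \<Rightarrow> bool \<Rightarrow> bool \<Rightarrow> bool \<Rightarrow> bool \<Rightarrow> ('e edge \<Rightarrow> bool) set" where
  "colourings G t1 t2 t3 t4 = {\<beta> \<in> all_edges G \<rightarrow>\<^sub>E UNIV.
     \<beta> (Dangling 1) = t1 \<and> \<beta> (Dangling 2) = t2 \<and> \<beta> (Dangling 3) = t3 \<and> \<beta> (Dangling 4) = t4}"

lemma finite_colourings: "four_ary_construction G \<Longrightarrow> finite (colourings G t1 t2 t3 t4)"
  unfolding colourings_def
  by (rule finite_subset[OF _ finite_PiE[OF finite_all_edges, of G "\<lambda>_. UNIV"]]) auto

lemma sum_by_boundary:
  fixes h :: "bool \<Rightarrow> bool \<Rightarrow> bool \<Rightarrow> bool \<Rightarrow> real"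
  assumes G: "four_ary_construction G"
  shows "(\<Sum>\<beta>\<in>all_edges G \<rightarrow>\<^sub>E UNIV. at_boundary h \<beta> * w \<beta>) =
    (\<Sum>t1\<in>UNIV. \<Sum>t2\<in>UNIV. \<Sum>t3\<in>UNIV. \<Sum>t4\<in>UNIV. h t1 t2 t3 t4 * sum w (colourings G t1 t2 t3 t4))"
proof -
  let ?B = "all_edges G \<rightarrow>\<^sub>E (UNIV :: bool set)"
  let ?d = "\<lambda>\<beta> :: 'b edge \<Rightarrow> bool. (\<beta> (Dangling 1), \<beta> (Dangling 2), \<beta> (Dangling 3), \<beta> (Dangling 4))"
  have "finite ?B" using finite_all_edges[OF G] by (auto intro: finite_PiE)
  then have "(\<Sum>\<beta>\<in>?B. at_boundary h \<beta> * w \<beta>) =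
      (\<Sum>t\<in>UNIV. \<Sum>\<beta>\<in>{\<beta> \<in> ?B. ?d \<beta> = t}. at_boundary h \<beta> * w \<beta>)"
    by (intro sum.group[symmetric]) auto
  also have "\<dots> = (\<Sum>(t1, t2, t3, t4)\<in>UNIV. h t1 t2 t3 t4 * sum w (colourings G t1 t2 t3 t4))"
    by (intro sum.cong refl) (auto simp: colourings_def sum_distrib_left intro!: sum.cong)
  finally show ?thesis by (simp add: sum.cartesian_product case_prod_beta)
qed

text \<open>The three pairings of the ends, numbered in the order of the parameters
  \<open>a\<close>, \<open>b\<close>, \<open>c\<close>; every other code stands for the system that
  makes all four ends equal.\<close>

definition joined :: "nat \<Rightarrow> bool \<Rightarrow> bool \<Rightarrow> bool \<Rightarrow> bool \<Rightarrow> bool" where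
  "joined c y1 y2 y3 y4 \<longleftrightarrow>
     (if c = 0 then y1 = y2 \<and> y3 = y4 else if c = 1 then y1 = y4 \<and> y2 = y3
      else if c = 2 then y1 = y3 \<and> y2 = y4 else y1 = y2 \<and> y2 = y3 \<and> y3 = y4)"

lemma joined_even: "joined c y1 y2 y3 y4 \<Longrightarrow> even (ones y1 y2 y3 y4)"
  by (cases y1; cases y2; cases y3; cases y4) (auto simp: joined_def ones_def split: if_splits)

lemma joined_and:
  "\<lbrakk>joined c y1 y2 y3 y4; joined c z1 z2 z3 z4\<rbrakk> \<Longrightarrow>
     joined c (y1 \<and> z1) (y2 \<and> z2) (y3 \<and> z3) (y4 \<and> z4)"
  by (auto simp: joined_def split: if_splits)

lemma joined_xor:
  "\<lbrakk>joined c y1 y2 y3 y4; joined c z1 z2 z3 z4\<rbrakk> \<Longrightarrow>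
     joined c (y1 \<noteq> z1) (y2 \<noteq> z2) (y3 \<noteq> z3) (y4 \<noteq> z4)"
  by (auto simp: joined_def split: if_splits)

text \<open>A non-constant even word satisfies exactly one of the four systems, a pairing; a
  constant word satisfies all of them, so the last coefficient must bring the total up to
  \<open>d\<close>. The inequality \<open>a + b + c \<le> d\<close> makes this coefficient
  nonnegative.\<close>

lemma eight_vertex_joined:
  "eight_vertex (a, b, c, d) y1 y2 y3 y4 =
     (\<Sum>k<4. ([a, b, c, d - a - b - c] ! k) * of_bool (joined k y1 y2 y3 y4))"
  by (cases y1; cases y2; cases y3; cases y4)
    (simp_all add: eight_vertex_def joined_def numeral_eq_Suc)

text \<open>
  The solutions of a system of pairwise equalities are closed under pointwise conjunction.
  Solutions with boundaries \<open>0011\<close> and \<open>0110\<close>, say, would thus give one with boundary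
  \<open>0010\<close>, which the handshake lemma forbids; so at most one of the three pairings of the
  dangling edges is realised.
\<close>

lemma card_joined_colourings:
  fixes c :: "'v \<Rightarrow> nat"
  assumes G: "four_ary_construction (G :: ('v, 'e) construction)"
  defines "N \<equiv> \<lambda>t1 t2 t3 t4. {\<beta> \<in> colourings G t1 t2 t3 t4. \<forall>v\<in>verts G. at_vertex G (joined (c v)) \<beta> v}"
  shows "card (N False False True True) + card (N False True True False) + card (N False True False True)
    \<le> card (N False False False False)"
proof -
  have fin: "finite (N t1 t2 t3 t4)" for t1 t2 t3 t4
    unfolding N_def using finite_colourings[OF G] by auto
  \<comment> \<open>Solutions are closed under exclusive or, so adding a fixed solution
    \<open>\<alpha>\<close> with the same boundary injects them into the solutions with boundary
    \<open>0000\<close>.\<close>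
  have le: "card (N t1 t2 t3 t4) \<le> card (N False False False False)" for t1 t2 t3 t4
  proof (cases "N t1 t2 t3 t4 = {}")
    case False
    then obtain \<alpha> where \<alpha>: "\<alpha> \<in> N t1 t2 t3 t4" by blast
    define x where "x \<beta> = restrict (\<lambda>e. \<beta> e \<noteq> \<alpha> e) (all_edges G)" for \<beta>
    have x: "x \<beta> (fst (end_at G v i)) = (\<beta> (fst (end_at G v i)) \<noteq> \<alpha> (fst (end_at G v i)))"
      if "v \<in> verts G" "i \<in> {1..4}" for v i \<beta>
      unfolding x_def using fst_edge_ends[OF end_at_in_edge_ends[OF G that]] by simp
    have xD: "x \<beta> (Dangling i) = (\<beta> (Dangling i) \<noteq> \<alpha> (Dangling i))" if "i \<in> {1..4}" for i \<beta>
      using that by (auto simp: x_def all_edges_def)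
    show ?thesis
    proof (rule card_inj_on_le)
      show "inj_on x (N t1 t2 t3 t4)"
      proof (rule inj_onI)
        fix \<beta> \<beta>' assume *: "\<beta> \<in> N t1 t2 t3 t4" "\<beta>' \<in> N t1 t2 t3 t4" "x \<beta> = x \<beta>'"
        then have "\<beta> \<in> all_edges G \<rightarrow>\<^sub>E UNIV" "\<beta>' \<in> all_edges G \<rightarrow>\<^sub>E UNIV"
          by (auto simp: N_def colourings_def)
        then show "\<beta> = \<beta>'"
        proof (rule PiE_ext)
          fix e assume "e \<in> all_edges G"
          then show "\<beta> e = \<beta>' e" using fun_cong[OF *(3), of e] by (auto simp: x_def)
        qed
      qed
      show "x ` N t1 t2 t3 t4 \<subseteq> N False False False False"
      proof
        fix \<xi> assume "\<xi> \<in> x ` N t1 t2 t3 t4"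
        then obtain \<beta> where \<beta>: "\<beta> \<in> N t1 t2 t3 t4" and \<xi>: "\<xi> = x \<beta>" by blast
        have "at_vertex G (joined (c v)) \<xi> v" if v: "v \<in> verts G" for v
        proof -
          have "at_vertex G (joined (c v)) \<beta> v" "at_vertex G (joined (c v)) \<alpha> v"
            using v \<alpha> \<beta> by (simp_all add: N_def)
          from joined_xor[OF this] show ?thesis
            by (simp add: \<xi> x v del: One_nat_def)
        qed
        moreover have "\<xi> \<in> colourings G False False False False"
          using \<alpha> \<beta> unfolding \<xi> colourings_def N_def
          by (simp add: xD del: One_nat_def) (simp add: x_def)
        ultimately show "\<xi> \<in> N False False False False" by (simp add: N_def)
      qed
    qed (rule fin)
  qed simp
  have odd: False if \<beta>: "\<beta> \<in> N t1 t2 t3 t4" and \<gamma>: "\<gamma> \<in> N u1 u2 u3 u4"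
    and "odd (ones (t1 \<and> u1) (t2 \<and> u2) (t3 \<and> u3) (t4 \<and> u4))" for \<beta> \<gamma> t1 t2 t3 t4 u1 u2 u3 u4
  proof -
    let ?\<delta> = "\<lambda>e. \<beta> e \<and> \<gamma> e"
    have "even (at_vertex G ones ?\<delta> v)" if "v \<in> verts G" for v
      using that \<beta> \<gamma> by (intro joined_even[of "c v"] joined_and) (auto simp: N_def)
    then have "even (at_boundary ones ?\<delta>)" by (rule even_boundary[OF G])
    with that show False by (simp add: N_def colourings_def)
  qed
  consider "N False False True True = {}" "N False True True False = {}" |
    "N False False True True = {}" "N False True False True = {}" |
    "N False True True False = {}" "N False True False True = {}"
    using odd[of _ False False True True _ False True True False]
      odd[of _ False False True True _ False True False True]
      odd[of _ False True True False _ False True False True]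
    by (auto simp: ones_def) blast
  then show ?thesis
    by cases (use le in simp_all)
qed

text \<open>Expanding each weight into its \<open>joined\<close> systems makes the sum a combination
  of solution counts with nonnegative coefficients, so the inequality of
  \<open>card_joined_colourings\<close> passes to it. Handshaking and complementation of colours
  give the eight-vertex form.\<close>

lemma sum_colourings_eight_vertex:
  assumes G: "four_ary_construction (G :: ('v, 'e) construction)"
    and w: "\<forall>v\<in>verts G. \<exists>a b c d. p v = (a, b, c, d) \<and> 0 \<le> a \<and> 0 \<le> b \<and> 0 \<le> c \<and> a + b + c \<le> d"
  shows "\<exists>a b c d. (\<lambda>t1 t2 t3 t4. \<Sum>\<beta>\<in>colourings G t1 t2 t3 t4. \<Prod>v\<in>verts G. at_vertex G (eight_vertex (p v)) \<beta> v) =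
    eight_vertex (a, b, c, d) \<and> 0 \<le> a \<and> 0 \<le> b \<and> 0 \<le> c \<and> a + b + c \<le> d"
proof -
  have finV: "finite (verts G)" using G by (simp add: four_ary_construction_def)
  define W where "W \<beta> = (\<Prod>v\<in>verts G. at_vertex G (eight_vertex (p v)) \<beta> v)" for \<beta>
  define T where "T t1 t2 t3 t4 = sum W (colourings G t1 t2 t3 t4)" for t1 t2 t3 t4
  define q where "q v k = (case p v of (a, b, c, d) \<Rightarrow> [a, b, c, d - a - b - c] ! k)" for v and k :: nat
  have q: "0 \<le> q v k" if "v \<in> verts G" "k < 4" for v k
    using bspec[OF w that(1)] that(2) by (auto simp: q_def less_Suc_eq numeral_eq_Suc)
  let ?N = "\<lambda>c t1 t2 t3 t4. {\<beta> \<in> colourings G t1 t2 t3 t4. \<forall>v\<in>verts G. at_vertex G (joined (c v)) \<beta> v}"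
  let ?C = "verts G \<rightarrow>\<^sub>E {..<4::nat}"
  have T: "T t1 t2 t3 t4 = (\<Sum>c\<in>?C. (\<Prod>v\<in>verts G. q v (c v)) * real (card (?N c t1 t2 t3 t4)))"
    for t1 t2 t3 t4
  proof -
    have "W \<beta> = (\<Sum>c\<in>?C. (\<Prod>v\<in>verts G. q v (c v)) *
        of_bool (\<forall>v\<in>verts G. at_vertex G (joined (c v)) \<beta> v))" for \<beta>
    proof -
      have all: "(\<Prod>v\<in>verts G. of_bool (at_vertex G (joined (c v)) \<beta> v)) =
          (of_bool (\<forall>v\<in>verts G. at_vertex G (joined (c v)) \<beta> v) :: real)" for c
        by (cases "\<forall>v\<in>verts G. at_vertex G (joined (c v)) \<beta> v")
          (use finV in \<open>auto simp del: One_nat_def intro!: prod.neutral prod_zero\<close>)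
      have "W \<beta> = (\<Prod>v\<in>verts G. \<Sum>k<4. q v k * of_bool (at_vertex G (joined k) \<beta> v))"
        unfolding W_def
      proof (intro prod.cong refl)
        fix v
        obtain a b c d where "p v = (a, b, c, d)" by (cases "p v") auto
        then show "at_vertex G (eight_vertex (p v)) \<beta> v =
            (\<Sum>k<4. q v k * of_bool (at_vertex G (joined k) \<beta> v))"
          by (simp only: q_def prod.case eight_vertex_joined)
      qed
      also have "\<dots> = (\<Sum>c\<in>?C. \<Prod>v\<in>verts G. q v (c v) * of_bool (at_vertex G (joined (c v)) \<beta> v))"
        by (rule prod_sum_PiE) (use finV in auto)
      also have "\<dots> = (\<Sum>c\<in>?C. (\<Prod>v\<in>verts G. q v (c v)) *
          (\<Prod>v\<in>verts G. of_bool (at_vertex G (joined (c v)) \<beta> v)))"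
        by (simp only: prod.distrib)
      also have "\<dots> = (\<Sum>c\<in>?C. (\<Prod>v\<in>verts G. q v (c v)) *
          of_bool (\<forall>v\<in>verts G. at_vertex G (joined (c v)) \<beta> v))"
        by (simp only: all)
      finally show ?thesis .
    qed
    note W = this
    have "T t1 t2 t3 t4 = (\<Sum>c\<in>?C. \<Sum>\<beta>\<in>colourings G t1 t2 t3 t4. (\<Prod>v\<in>verts G. q v (c v)) *
        of_bool (\<forall>v\<in>verts G. at_vertex G (joined (c v)) \<beta> v))"
      unfolding T_def by (subst sum.swap) (rule sum.cong[OF refl W])
    then show ?thesis
      using finite_colourings[OF G]
      by (simp only: sum_distrib_left[symmetric] sum_of_bool_eq Int_def mem_Collect_eq)
  qed
  have pos: "0 \<le> (\<Prod>v\<in>verts G. q v (c v))" if "c \<in> ?C" for c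
    using that q by (intro prod_nonneg) auto
  have nonneg: "0 \<le> T t1 t2 t3 t4" for t1 t2 t3 t4
    unfolding T using pos by (intro sum_nonneg mult_nonneg_nonneg) auto
  have le: "T False False True True + T False True True False + T False True False True \<le> T False False False False"
    unfolding T sum.distrib[symmetric] distrib_left[symmetric] of_nat_add[symmetric]
    using pos card_joined_colourings[OF G]
    by (intro sum_mono mult_left_mono) (auto simp only: of_nat_le_iff)
  have odd: "T t1 t2 t3 t4 = 0" if o: "odd (ones t1 t2 t3 t4)" for t1 t2 t3 t4
    unfolding T_def
  proof (intro sum.neutral ballI)
    fix \<beta> assume "\<beta> \<in> colourings G t1 t2 t3 t4"
    then have "odd (at_boundary ones \<beta>)" using o by (simp add: colourings_def)
    then obtain v where "v \<in> verts G" "odd (at_vertex G ones \<beta> v)"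
      using even_boundary[OF G] by blast
    then show "W \<beta> = 0" unfolding W_def using finV eight_vertex_odd by (intro prod_zero) blast+
  qed
  \<comment> \<open>Complementing all colours is a bijection that preserves every weight, since
    \<open>eight_vertex\<close> takes equal values at complementary words.\<close>
  have flip: "T (\<not> t1) (\<not> t2) (\<not> t3) (\<not> t4) = T t1 t2 t3 t4" for t1 t2 t3 t4
  proof -
    define n where "n \<beta> = restrict (\<lambda>e. \<not> \<beta> e) (all_edges G)" for \<beta>
    have n: "n \<beta> (fst (end_at G v i)) = (\<not> \<beta> (fst (end_at G v i)))"
      if "v \<in> verts G" "i \<in> {1..4}" for v i \<beta>
      unfolding n_def using fst_edge_ends[OF end_at_in_edge_ends[OF G that]] by simp
    have nD: "n \<beta> (Dangling i) = (\<not> \<beta> (Dangling i))" if "i \<in> {1..4}" for i \<beta>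
      using that by (auto simp: n_def all_edges_def)
    have nn: "n (n \<beta>) = \<beta>" if "\<beta> \<in> colourings G t1 t2 t3 t4" for \<beta> t1 t2 t3 t4
      using that by (auto simp: n_def colourings_def fun_eq_iff PiE_def extensional_def)
    have mem: "n \<beta> \<in> colourings G (\<not> t1) (\<not> t2) (\<not> t3) (\<not> t4)"
      if "\<beta> \<in> colourings G t1 t2 t3 t4" for \<beta> t1 t2 t3 t4
      using that unfolding colourings_def by (simp add: nD del: One_nat_def) (simp add: n_def)
    have eight: "eight_vertex r (\<not> y1) (\<not> y2) (\<not> y3) (\<not> y4) = eight_vertex r y1 y2 y3 y4" for r y1 y2 y3 y4
      by (cases r; cases y1; cases y2; cases y3; cases y4) (simp_all add: eight_vertex_def)
    have "W (n \<beta>) = W \<beta>" for \<beta>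
      unfolding W_def by (intro prod.cong refl) (simp add: n eight del: One_nat_def)
    then show ?thesis
      unfolding T_def using nn mem[of _ t1 t2 t3 t4] mem[of _ "\<not> t1" "\<not> t2" "\<not> t3" "\<not> t4"]
      by (intro sum.reindex_bij_witness[where i = n and j = n]) simp_all
  qed
  have "T t1 t2 t3 t4 = eight_vertex (T False False True True, T False True True False,
      T False True False True, T False False False False) t1 t2 t3 t4" for t1 t2 t3 t4
    using odd[of t1 t2 t3 t4] flip[of t1 t2 t3 t4]
    by (cases t1; cases t2; cases t3; cases t4) (simp_all add: eight_vertex_def ones_def)
  then have "T = eight_vertex (T False False True True, T False True True False,
      T False True False True, T False False False False)" by (intro ext)
  moreover have "(\<lambda>t1 t2 t3 t4. \<Sum>\<beta>\<in>colourings G t1 t2 t3 t4.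
      \<Prod>v\<in>verts G. at_vertex G (eight_vertex (p v)) \<beta> v) = T"
    by (simp only: T_def[abs_def] W_def[abs_def])
  ultimately have "(\<lambda>t1 t2 t3 t4. \<Sum>\<beta>\<in>colourings G t1 t2 t3 t4.
      \<Prod>v\<in>verts G. at_vertex G (eight_vertex (p v)) \<beta> v) =
      eight_vertex (T False False True True, T False True True False,
        T False True False True, T False False False False)" by (simp only:)
  with nonneg le show ?thesis by blast
qed

section \<open>The region in Fourier coordinates, and its closure\<close>

lemma eight_vertex_scale:
  "eight_vertex (k * a, k * b, k * c, k * d) y1 y2 y3 y4 = k * eight_vertex (a, b, c, d) y1 y2 y3 y4"
  by (simp add: eight_vertex_def)

text \<open>The signs of the first three coordinates are the first three regions, and
  \<open>A + B + C \<le> D\<close> says \<open>c \<le> a + b + d\<close>. Nonnegativity of the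
  parameters comes from the inverse transform, as in \<open>4 * a = D - A + B - C\<close>, which is
  at least \<open>2 * B\<close>.\<close>

lemma region_iff_spectrum:
  "(a, b, c, d) \<in> A_le \<inter> B_le \<inter> C_ge \<inter> F_bar \<longleftrightarrow>
     (\<exists>A B C D. spectrum (a, b, c, d) = (- A, - B, C, D) \<and> 0 \<le> A \<and> 0 \<le> B \<and> 0 \<le> C \<and> A + B + C \<le> D)"
proof
  assume "(a, b, c, d) \<in> A_le \<inter> B_le \<inter> C_ge \<inter> F_bar"
  then show "\<exists>A B C D. spectrum (a, b, c, d) = (- A, - B, C, D) \<and> 0 \<le> A \<and> 0 \<le> B \<and> 0 \<le> C \<and> A + B + C \<le> D"
    by (rule_tac x = "b + c - a - d" in exI, rule_tac x = "a + c - b - d" in exI,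
        rule_tac x = "c + d - a - b" in exI, rule_tac x = "a + b + c + d" in exI)
      (simp add: spectrum_def A_le_def B_le_def C_ge_def F_bar_def)
next
  assume "\<exists>A B C D. spectrum (a, b, c, d) = (- A, - B, C, D) \<and> 0 \<le> A \<and> 0 \<le> B \<and> 0 \<le> C \<and> A + B + C \<le> D"
  then have "0 \<le> b + c - a - d" "0 \<le> a + c - b - d" "0 \<le> c + d - a - b"
      "(b + c - a - d) + (a + c - b - d) + (c + d - a - b) \<le> a + b + c + d"
    unfolding spectrum_def by auto
  then show "(a, b, c, d) \<in> A_le \<inter> B_le \<inter> C_ge \<inter> F_bar"
    by (simp add: A_le_def B_le_def C_ge_def F_bar_def nonneg_params_def)
qed

text \<open>Applying \<open>spectrum\<close> twice multiplies by 4, so the witnesses are the same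
  formula divided by 4.\<close>

lemma spectrum_surj: "\<exists>a b c d. spectrum (a, b, c, d) = (A, B, C, D)"
  by (rule exI[of _ "(D + A - B - C) / 4"], rule exI[of _ "(D - A + B - C) / 4"],
      rule exI[of _ "(D - A - B + C) / 4"], rule exI[of _ "(D + A + B + C) / 4"])
    (simp add: spectrum_def field_simps)

theorem mainTheorem3:
  fixes G :: "('v, 'e) construction"
  assumes "planar_four_ary_construction G"
    and "\<And>v. v \<in> verts G \<Longrightarrow>
           weight G v \<in> eight_vertex ` (A_le \<inter> B_le \<inter> C_ge \<inter> F_bar)"
  shows "constraint_function G \<in> eight_vertex ` (A_le \<inter> B_le \<inter> C_ge \<inter> F_bar)"
proof -
  let ?R = "A_le \<inter> B_le \<inter> C_ge \<inter> F_bar"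
  have G: "four_ary_construction G" using assms(1) by (simp add: planar_four_ary_construction_def)
  then have fin: "finite (verts G)" by (simp add: four_ary_construction_def)
  obtain p where p: "\<And>v. v \<in> verts G \<Longrightarrow> weight G v = eight_vertex (p v) \<and> p v \<in> ?R"
    using assms(2) unfolding image_iff by metis
  define q where "q v = (case spectrum (p v) of (a, b, c, d) \<Rightarrow> (- a, - b, c, d))" for v
  have q: "\<exists>a b c d. spectrum (p v) = (- a, - b, c, d) \<and> q v = (a, b, c, d) \<and>
      0 \<le> a \<and> 0 \<le> b \<and> 0 \<le> c \<and> a + b + c \<le> d" if "v \<in> verts G" for v
  proof -
    obtain a b c d where "p v = (a, b, c, d)" by (cases "p v") auto
    with p[OF that] show ?thesis
      using region_iff_spectrum[of a b c d] by (auto simp: q_def)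
  qed
  obtain A B C D where T: "(\<lambda>t1 t2 t3 t4. \<Sum>\<beta>\<in>colourings G t1 t2 t3 t4.
        \<Prod>v\<in>verts G. at_vertex G (eight_vertex (q v)) \<beta> v) = eight_vertex (A, B, C, D)"
    and ABCD: "0 \<le> A" "0 \<le> B" "0 \<le> C" "A + B + C \<le> D"
  proof -
    have "\<forall>v\<in>verts G. \<exists>a b c d. q v = (a, b, c, d) \<and> 0 \<le> a \<and> 0 \<le> b \<and> 0 \<le> c \<and> a + b + c \<le> d"
      using q by blast
    from sum_colourings_eight_vertex[of G q, OF G this] show thesis
      by (elim exE conjE) (rule that)
  qed
  \<comment> \<open>The powers of 8 and 2 come from the vertices and internal edges in
    \<open>constraint_function_fourier\<close>; the extra 8 is that of Fourier inversion for the
    resulting function.\<close>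
  define k :: real where "k = 8 * 2 ^ card (edges G) / 8 ^ card (verts G)"
  have k: "0 \<le> k" by (simp add: k_def)
  obtain a b c d where abcd: "spectrum (a, b, c, d) = (k * - A, k * - B, k * C, k * D)"
    using spectrum_surj by metis
  have "k * A + k * B + k * C \<le> k * D"
    using mult_left_mono[OF ABCD(4) k] by (simp only: distrib_left)
  then have R: "(a, b, c, d) \<in> ?R"
    unfolding region_iff_spectrum abcd using k ABCD
    by (rule_tac x = "k * A" in exI, rule_tac x = "k * B" in exI,
        rule_tac x = "k * C" in exI, rule_tac x = "k * D" in exI) simp
  \<comment> \<open>The signs of all vertices and internal edges collect into one boundary sign,
    which later turns \<open>(A, B, C, D)\<close> into \<open>(- A, - B, C, D)\<close>.\<close>
  have sign: "(\<Prod>v\<in>verts G. at_vertex G (eight_vertex (spectrum (p v))) \<beta> v) *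
      (\<Prod>e\<in>edges G. edge_sign (\<beta> (Internal e))) =
      at_boundary turn_sign \<beta> * (\<Prod>v\<in>verts G. at_vertex G (eight_vertex (q v)) \<beta> v)" for \<beta>
  proof -
    have "(\<Prod>v\<in>verts G. at_vertex G (eight_vertex (spectrum (p v))) \<beta> v) =
        (\<Prod>v\<in>verts G. at_vertex G turn_sign \<beta> v * at_vertex G (eight_vertex (q v)) \<beta> v)"
    proof (intro prod.cong refl)
      fix v assume "v \<in> verts G"
      then show "at_vertex G (eight_vertex (spectrum (p v))) \<beta> v =
          at_vertex G turn_sign \<beta> v * at_vertex G (eight_vertex (q v)) \<beta> v"
        using q[of v] eight_vertex_turn_sign by auto
    qed
    then have eq: "(\<Prod>v\<in>verts G. at_vertex G (eight_vertex (spectrum (p v))) \<beta> v) =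
        (\<Prod>v\<in>verts G. at_vertex G turn_sign \<beta> v) * (\<Prod>v\<in>verts G. at_vertex G (eight_vertex (q v)) \<beta> v)"
      by (simp only: prod.distrib)
    show ?thesis
    proof (cases "\<forall>v\<in>verts G. even (at_vertex G ones \<beta> v)")
      case True
      then have bd: "(\<Prod>v\<in>verts G. at_vertex G turn_sign \<beta> v) *
          (\<Prod>e\<in>edges G. edge_sign (\<beta> (Internal e))) = at_boundary turn_sign \<beta>"
        by (intro turn_sign_parity[OF assms(1)]) blast
      show ?thesis unfolding eq bd[symmetric] by (simp only: mult_ac)
    next
      \<comment> \<open>A vertex with an odd number of red ends has weight 0, so both sides
        vanish.\<close>
      case False
      then obtain v where "v \<in> verts G" "odd (at_vertex G ones \<beta> v)" by blast
      then have "(\<Prod>v\<in>verts G. at_vertex G (eight_vertex (q v)) \<beta> v) = 0"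
        using fin eight_vertex_odd by (intro prod_zero) blast+
      then show ?thesis unfolding eq by (simp only: mult_zero_left mult_zero_right)
    qed
  qed
  have "constraint_function G b1 b2 b3 b4 = eight_vertex (a, b, c, d) b1 b2 b3 b4" for b1 b2 b3 b4
  proof -
    let ?chi = "\<lambda>y1 y2 y3 y4. chi y1 b1 * chi y2 b2 * chi y3 b3 * chi y4 b4"
    let ?S = "\<Sum>t1\<in>UNIV. \<Sum>t2\<in>UNIV. \<Sum>t3\<in>UNIV. \<Sum>t4\<in>UNIV.
        eight_vertex (- A, - B, C, D) t1 t2 t3 t4 * ?chi t1 t2 t3 t4"
    have "8 ^ card (verts G) * constraint_function G b1 b2 b3 b4 =
        2 ^ card (edges G) * (\<Sum>\<beta>\<in>all_edges G \<rightarrow>\<^sub>E UNIV.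
          at_boundary (\<lambda>y1 y2 y3 y4. turn_sign y1 y2 y3 y4 * ?chi y1 y2 y3 y4) \<beta> *
          (\<Prod>v\<in>verts G. at_vertex G (eight_vertex (q v)) \<beta> v))"
    proof (subst constraint_function_fourier[where p = p, OF G])
      show "weight G v = eight_vertex (p v)" if "v \<in> verts G" for v using p[OF that] ..
    qed (simp only: sign, simp only: mult_ac)
    also have "\<dots> = 2 ^ card (edges G) * (\<Sum>t1\<in>UNIV. \<Sum>t2\<in>UNIV. \<Sum>t3\<in>UNIV. \<Sum>t4\<in>UNIV.
        turn_sign t1 t2 t3 t4 * ?chi t1 t2 t3 t4 * eight_vertex (A, B, C, D) t1 t2 t3 t4)"
      using sum_by_boundary[OF G, of "\<lambda>t1 t2 t3 t4. turn_sign t1 t2 t3 t4 * ?chi t1 t2 t3 t4"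
          "\<lambda>\<beta>. \<Prod>v\<in>verts G. at_vertex G (eight_vertex (q v)) \<beta> v"]
      by (simp only: T[symmetric])
    also have "\<dots> = 2 ^ card (edges G) * ?S"
      by (simp only: eight_vertex_turn_sign mult_ac)
    finally have 1: "8 * constraint_function G b1 b2 b3 b4 = k * ?S"
      by (simp add: k_def field_simps)
    have "8 * eight_vertex (a, b, c, d) b1 b2 b3 b4 = k * ?S"
      using abcd unfolding spectrum_def prod.case
      by (simp only: eight_vertex_fourier eight_vertex_scale sum_distrib_left mult.assoc)
    then show ?thesis using 1 by linarith
  qed
  then have "constraint_function G = eight_vertex (a, b, c, d)" by (intro ext)
  then show ?thesis using R by blast
qed

end
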